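(* Let $n\geq 2$, and let $a$, $b$ and $\Delta_n$ be the elements of $B_n(\mathbb{R}P^2)$ given in terms of Van Buskirk's generators by $$a=\sigma_{n-1}^{-1}\cdots\sigma_1^{-1}\rho_1,\qquad b=\sigma_{n-2}^{-1}\cdots\sigma_1^{-1}\rho_1,$$ $$\Delta_n=(\sigma_1\cdots\sigma_{n-1})(\sigma_1\cdots\sigma_{n-2})\cdots(\sigma_1\sigma_2)\sigma_1.$$ Then: (a) the subgroup $\langle a,\Delta_n\rangle$ of $B_n(\mathbb{R}P^2)$ is isomorphic to $\operatorname{Dic}_{8n}$; (b) the subgroup $\langle b,\Delta_n a^{-1}\rangle$ of $B_n(\mathbb{R}P^2)$ is isomorphic to $\operatorname{Dic}_{8(n-1)}$.
   Context: $B_n(\mathbb{R}P^2)$ is the $n$-th braid group of the real projective plane, i.e. the fundamental group of the space of unordered $n$-tuples of distinct points of $\mathbb{R}P^2$. By Van Buskirk it is presented by generators $\sigma_1,\ldots,\sigma_{n-1},\rho_1,\ldots,\rho_n$ and relations: $\sigma_i\sigma_j=\sigma_j\sigma_i$ if $|i-j|\geq 2$; $\sigma_i\sigma_{i+1}\sigma_i=\sigma_{i+1}\sigma_i\sigma_{i+1}$ for $1\leq i\leq n-2$; $\sigma_i\rho_j=\rho_j\sigma_i$ for $j\neq i,i+1$; $\rho_{i+1}=\sigma_i^{-1}\rho_i\sigma_i^{-1}$ for $1\leq i\leq n-1$; $\rho_{i+1}^{-1}\rho_i^{-1}\rho_{i+1}\rho_i=\sigma_i^2$ for $1\leq i\leq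 n-1$; $\rho_1^2=\sigma_1\sigma_2\cdots\sigma_{n-2}\sigma_{n-1}^2\sigma_{n-2}\cdots\sigma_2\sigma_1$. For $n=2$, the product of the $\sigma$'s in $b$ is empty, so $b=\rho_1$, and $\Delta_2=\sigma_1$. For $m\geq 2$, $\operatorname{Dic}_{4m}$ denotes the dicyclic group of order $4m$, with presentation $\langle x,y \mid x^m=y^2,\ yxy^{-1}=x^{-1}\rangle$. *)

theory Defs
  imports "HOL-Algebra.Algebra"
begin

section \<open>Groups given by generators and relations\<close>

text \<open>
  A word is a list of letters; the letter \<open>(g, True)\<close> stands for the generator \<open>g\<close>
  and \<open>(g, False)\<close> for its formal inverse. A relation \<open>u = v\<close> is the pair \<open>(u, v)\<close>.
\<close>

type_synonym 'g word = "('g \<times> bool) list"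

abbreviation pos :: "'g \<Rightarrow> 'g \<times> bool" where "pos g \<equiv> (g, True)"
abbreviation neg :: "'g \<Rightarrow> 'g \<times> bool" where "neg g \<equiv> (g, False)"

definition words :: "'g set \<Rightarrow> 'g word set" where
  "words S = lists (S \<times> UNIV)"

definition inv_word :: "'g word \<Rightarrow> 'g word" where
  "inv_word w = rev (map (\<lambda>(g, e). (g, \<not> e)) w)"

text \<open>Equality of words in the group with generators \<open>S\<close> and relations \<open>R\<close>.\<close>

inductive word_eq :: "'g set \<Rightarrow> ('g word \<times> 'g word) set \<Rightarrow> 'g word \<Rightarrow> 'g word \<Rightarrow> bool"
  for S R where
  refl: "w \<in> words S \<Longrightarrow> word_eq S R w w"
| sym: "word_eq S R u v \<Longrightarrow> word_eq S R v u"
| trans: "word_eq S R u v \<Longrightarrow> word_eq S R v w \<Longrightarrow> word_eq S R u w"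
| append: "word_eq S R u u' \<Longrightarrow> word_eq S R v v' \<Longrightarrow> word_eq S R (u @ v) (u' @ v')"
| cancel: "g \<in> S \<Longrightarrow> word_eq S R [(g, e), (g, \<not> e)] []"
| rel: "(u, v) \<in> R \<Longrightarrow> u \<in> words S \<Longrightarrow> v \<in> words S \<Longrightarrow> word_eq S R u v"

definition word_class :: "'g set \<Rightarrow> ('g word \<times> 'g word) set \<Rightarrow> 'g word \<Rightarrow> 'g word set" where
  "word_class S R w = {v. word_eq S R w v}"

definition presented_group :: "'g set \<Rightarrow> ('g word \<times> 'g word) set \<Rightarrow> 'g word set monoid" where
  "presented_group S R =
    \<lparr>carrier = word_class S R ` words S,
     monoid.mult = (\<lambda>A B. \<Union>u\<in>A. \<Union>v\<in>B. word_class S R (u @ v)),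
     monoid.one = word_class S R []\<rparr>"

lemma word_eq_words: "word_eq S R u v \<Longrightarrow> u \<in> words S \<and> v \<in> words S"
  by (induction rule: word_eq.induct) (simp_all add: words_def)

lemma word_class_eq_iff:
  assumes "u \<in> words S"
  shows "word_class S R u = word_class S R v \<longleftrightarrow> word_eq S R u v"
proof
  assume "word_class S R u = word_class S R v"
  then have "word_eq S R v u"
    using word_eq.refl[OF assms, of R] unfolding word_class_def by blast
  then show "word_eq S R u v" by (rule word_eq.sym)
next
  assume "word_eq S R u v"
  then have "word_eq S R u w \<longleftrightarrow> word_eq S R v w" for w
    using word_eq.trans[OF \<open>word_eq S R u v\<close>, of w]
      word_eq.trans[OF word_eq.sym[OF \<open>word_eq S R u v\<close>], of w] by blast
  then show "word_class S R u = word_class S R v"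
    by (simp add: word_class_def)
qed

lemma mult_presented_group:
  assumes "u \<in> words S" "v \<in> words S"
  shows "word_class S R u \<otimes>\<^bsub>presented_group S R\<^esub> word_class S R v = word_class S R (u @ v)"
proof -
  have uv: "u @ v \<in> words S" using assms by (auto simp: words_def)
  have "word_class S R (u' @ v') = word_class S R (u @ v)"
    if "u' \<in> word_class S R u" "v' \<in> word_class S R v" for u' v'
    using that word_class_eq_iff[OF uv, of R "u' @ v'"] word_eq.append[of S R u u' v v']
    by (simp add: word_class_def)
  moreover have "u \<in> word_class S R u" "v \<in> word_class S R v"
    using assms by (simp_all add: word_class_def word_eq.refl)
  ultimately have "(\<Union>u'\<in>word_class S R u. \<Union>v'\<in>word_class S R v. word_class S R (u' @ v'))
      = word_class S R (u @ v)"
    by blast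
  then show ?thesis by (simp add: presented_group_def)
qed

lemma inv_word_words: "w \<in> words S \<Longrightarrow> inv_word w \<in> words S"
  unfolding words_def inv_word_def by (induction rule: lists.induct) auto

lemma inv_word_left:
  assumes "w \<in> words S"
  shows "word_eq S R (inv_word w @ w) []"
  using assms
proof (induction w)
  case Nil
  then show ?case by (auto simp: inv_word_def words_def intro: word_eq.refl)
next
  case (Cons x w)
  obtain g e where x: "x = (g, e)" by (cases x)
  have w: "w \<in> words S" and g: "g \<in> S" using Cons.prems x by (auto simp: words_def)
  have "word_eq S R ([(g, \<not> e), (g, e)] @ w) ([] @ w)"
    using word_eq.append[OF word_eq.cancel[OF g, of R "\<not> e"] word_eq.refl[OF w]] by simp
  then have "word_eq S R (inv_word w @ [(g, \<not> e), (g, e)] @ w) (inv_word w @ [] @ w)"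
    by (rule word_eq.append[OF word_eq.refl[OF inv_word_words[OF w]]])
  then have "word_eq S R (inv_word w @ [(g, \<not> e), (g, e)] @ w) (inv_word w @ w)"
    by simp
  from word_eq.trans[OF this Cons.IH[OF w]] show ?case
    using x by (simp add: inv_word_def)
qed

lemma group_presented_group: "group (presented_group S R)"
proof -
  let ?G = "presented_group S R" and ?c = "word_class S R"
  have car: "carrier ?G = ?c ` words S" and one: "\<one>\<^bsub>?G\<^esub> = ?c []"
    by (simp_all add: presented_group_def)
  have nil: "[] \<in> words S" and app: "\<And>u v. u \<in> words S \<Longrightarrow> v \<in> words S \<Longrightarrow> u @ v \<in> words S"
    by (auto simp: words_def)
  show ?thesis
  proof (rule groupI)
    fix x assume "x \<in> carrier ?G"
    then obtain w where w: "w \<in> words S" "x = ?c w" by (auto simp: car)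
    have "?c (inv_word w) \<otimes>\<^bsub>?G\<^esub> x = \<one>\<^bsub>?G\<^esub>"
      using w by (simp add: one mult_presented_group inv_word_words app
          word_class_eq_iff inv_word_left)
    then show "\<exists>y\<in>carrier ?G. y \<otimes>\<^bsub>?G\<^esub> x = \<one>\<^bsub>?G\<^esub>"
      using w by (auto simp: car inv_word_words)
  qed (auto simp: car one mult_presented_group app nil)
qed


section \<open>The braid groups of the projective plane\<close>

datatype vb_gen = Sigma nat | Rho nat

abbreviation sig :: "nat \<Rightarrow> vb_gen \<times> bool" where "sig i \<equiv> pos (Sigma i)"
abbreviation sig_inv :: "nat \<Rightarrow> vb_gen \<times> bool" where "sig_inv i \<equiv> neg (Sigma i)"
abbreviation rho :: "nat \<Rightarrow> vb_gen \<times> bool" where "rho j \<equiv> pos (Rho j)"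
abbreviation rho_inv :: "nat \<Rightarrow> vb_gen \<times> bool" where "rho_inv j \<equiv> neg (Rho j)"

definition vb_gens :: "nat \<Rightarrow> vb_gen set" where
  "vb_gens n = Sigma ` {1..n - 1} \<union> Rho ` {1..n}"

definition vb_rels :: "nat \<Rightarrow> (vb_gen word \<times> vb_gen word) set" where
  "vb_rels n =
     {([sig i, sig j], [sig j, sig i]) | i j.
        i \<in> {1..n - 1} \<and> j \<in> {1..n - 1} \<and> \<bar>int i - int j\<bar> \<ge> 2}
   \<union> {([sig i, sig (i + 1), sig i], [sig (i + 1), sig i, sig (i + 1)]) | i. i \<in> {1..n - 2}}
   \<union> {([sig i, rho j], [rho j, sig i]) | i j.
        i \<in> {1..n - 1} \<and> j \<in> {1..n} \<and> j \<noteq> i \<and> j \<noteq> i + 1}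
   \<union> {([rho (i + 1)], [sig_inv i, rho i, sig_inv i]) | i. i \<in> {1..n - 1}}
   \<union> {([rho_inv (i + 1), rho_inv i, rho (i + 1), rho i], [sig i, sig i]) | i. i \<in> {1..n - 1}}
   \<union> {([rho 1, rho 1],
        map sig [1..<n - 1] @ [sig (n - 1), sig (n - 1)] @ map sig (rev [1..<n - 1]))}"

text \<open>
  Van Buskirk's presentation of \<open>B\<^sub>n(\<real>P\<^sup>2)\<close>, the fundamental group of the space of unordered
  \<open>n\<close>-tuples of distinct points of the projective plane, taken as the definition for \<open>n \<ge> 2\<close>.
\<close>

definition braid_group_RP2 :: "nat \<Rightarrow> vb_gen word set monoid" where
  "braid_group_RP2 n = presented_group (vb_gens n) (vb_rels n)"

definition braid :: "nat \<Rightarrow> vb_gen word \<Rightarrow> vb_gen word set" where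
  "braid n w = word_class (vb_gens n) (vb_rels n) w"

definition elt_a :: "nat \<Rightarrow> vb_gen word set" where
  "elt_a n = braid n (map sig_inv (rev [1..<n]) @ [rho 1])"

definition elt_b :: "nat \<Rightarrow> vb_gen word set" where
  "elt_b n = braid n (map sig_inv (rev [1..<n - 1]) @ [rho 1])"

definition elt_Delta :: "nat \<Rightarrow> vb_gen word set" where
  "elt_Delta n = braid n (concat (map (\<lambda>k. map sig [1..<k + 1]) (rev [1..<n])))"

lemma braid_closed: "w \<in> words (vb_gens n) \<Longrightarrow> braid n w \<in> carrier (braid_group_RP2 n)"
  by (simp add: braid_def braid_group_RP2_def presented_group_def)

lemma elts_closed:
  assumes "n \<ge> 2"
  shows "elt_a n \<in> carrier (braid_group_RP2 n)"
    and "elt_b n \<in> carrier (braid_group_RP2 n)"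
    and "elt_Delta n \<in> carrier (braid_group_RP2 n)"
  using assms unfolding elt_a_def elt_b_def elt_Delta_def
  by (auto intro!: braid_closed simp: words_def vb_gens_def)

lemma vb_rels_words:
  assumes "n \<ge> 2"
  shows "vb_rels n \<subseteq> words (vb_gens n) \<times> words (vb_gens n)"
  using assms unfolding vb_rels_def by (auto simp: words_def vb_gens_def)


section \<open>Dicyclic groups\<close>

datatype dic_gen = Dic_x | Dic_y

text \<open>\<open>dicyclic_group m\<close> is the dicyclic group of order \<open>4 * m\<close>, for \<open>m \<ge> 2\<close>.\<close>

definition dicyclic_group :: "nat \<Rightarrow> dic_gen word set monoid" where
  "dicyclic_group m = presented_group UNIV
     {(replicate m (pos Dic_x), [pos Dic_y, pos Dic_y]),
      ([pos Dic_y, pos Dic_x, neg Dic_y], [neg Dic_x])}"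

end

theory Submission
  imports Defs "HOL-Library.Product_Plus"
begin

text \<open>
  The two dicyclic relations come from short computations in the braid group. With
  \<open>P\<^sub>m = \<rho>\<^sub>m \<dots> \<rho>\<^sub>1\<close>, one has \<open>a\<^sup>n = P\<^sub>n\<close> and \<open>b\<^sup>n\<^sup>-\<^sup>1 = P\<^sub>n\<^sub>-\<^sub>1\<close>, and
  \<open>P\<^sub>m\<^sup>2 = B\<^sub>m P\<^sub>m\<^sub>-\<^sub>1\<^sup>2\<close> for \<open>B\<^sub>m = \<sigma>\<^sub>m \<dots> \<sigma>\<^sub>n\<^sub>-\<^sub>1 \<sigma>\<^sub>n\<^sub>-\<^sub>1 \<dots> \<sigma>\<^sub>m\<close>, where \<open>B\<^sub>1 = \<rho>\<^sub>1\<^sup>2\<close>.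
  Hence \<open>P\<^sub>n\<^sup>2 = P\<^sub>n\<^sub>-\<^sub>1\<^sup>2 = B\<^sub>n\<^sub>-\<^sub>1 \<dots> B\<^sub>1\<close>, which is the full twist \<open>\<Delta>\<^sub>n\<^sup>2\<close>. The relations
  \<open>a \<Delta>\<^sub>n a = \<Delta>\<^sub>n\<close> and \<open>b (\<Delta>\<^sub>n a\<^sup>-\<^sup>1) b = \<Delta>\<^sub>n a\<^sup>-\<^sup>1\<close> follow from the action of \<open>\<Delta>\<^sub>n\<close> and \<open>a\<close> by
  conjugation on the generators.

  For the lower bound on the orders it then suffices, since \<open>a\<close> and \<open>b\<close> permute \<open>n\<close> and \<open>n - 1\<close>
  strands cyclically, that the full twist is not trivial. This is seen by forgetting all strands but
  two: it is mapped to \<open>-1\<close> in the quaternion group.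
\<close>

section \<open>Dicyclic groups\<close>

lemma word_class_in_carrier: "w \<in> words S \<Longrightarrow> word_class S R w \<in> carrier (presented_group S R)"
  by (simp add: presented_group_def)

section \<open>Evaluation of words and homomorphisms out of presented groups\<close>

context group
begin

primrec word_val :: "('g \<Rightarrow> 'a) \<Rightarrow> 'g word \<Rightarrow> 'a" where
  "word_val f [] = \<one>"
| "word_val f (l # w) = (if snd l then f (fst l) else inv (f (fst l))) \<otimes> word_val f w"

lemma word_val_closed: "f ` S \<subseteq> carrier G \<Longrightarrow> w \<in> words S \<Longrightarrow> word_val f w \<in> carrier G"
  by (induction w) (auto simp: words_def)

lemma word_val_append:
  assumes "f ` S \<subseteq> carrier G" "u \<in> words S" "v \<in> words S"
  shows "word_val f (u @ v) = word_val f u \<otimes> word_val f v"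
  using assms(2)
proof (induction u)
  case (Cons l u)
  then have "fst l \<in> S" "u \<in> words S" by (auto simp: words_def)
  moreover have "f (fst l) \<in> carrier G" using assms(1) \<open>fst l \<in> S\<close> by blast
  ultimately show ?case using Cons.IH assms(3)
    by (simp add: m_assoc word_val_closed[OF assms(1)])
qed (use assms in \<open>simp add: word_val_closed\<close>)

lemma word_val_eq:
  assumes "f ` S \<subseteq> carrier G"
    and "\<And>u v. (u, v) \<in> R \<Longrightarrow> u \<in> words S \<Longrightarrow> v \<in> words S \<Longrightarrow> word_val f u = word_val f v"
    and "word_eq S R u v"
  shows "word_val f u = word_val f v"
  using assms(3)
proof (induction rule: word_eq.induct)
  case (append u u' v v')
  then show ?case using word_eq_words[OF append(1)] word_eq_words[OF append(2)]
    by (simp add: word_val_append[OF assms(1)])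
next
  case (cancel g e)
  with assms(1) have "f g \<in> carrier G" by blast
  then show ?case by simp
next
  case (rel u v)
  then show ?case by (rule assms(2))
qed simp_all

text \<open>Von Dyck's theorem. A class is evaluated on a chosen representative;
  \<open>word_val_eq\<close> makes the choice immaterial.\<close>

lemma presented_group_hom:
  fixes f :: "'g \<Rightarrow> 'a"
  assumes "f ` S \<subseteq> carrier G"
    and "\<And>u v. (u, v) \<in> R \<Longrightarrow> u \<in> words S \<Longrightarrow> v \<in> words S \<Longrightarrow> word_val f u = word_val f v"
  obtains h where "h \<in> hom (presented_group S R) G"
    and "\<And>w. w \<in> words S \<Longrightarrow> h (word_class S R w) = word_val f w"
proof
  define h where "h A = word_val f (SOME w. w \<in> A)" for A :: "'g word set"
  have h: "h (word_class S R w) = word_val f w" if "w \<in> words S" for w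
  proof -
    have "(SOME v. v \<in> word_class S R w) \<in> word_class S R w"
      by (rule someI[of "\<lambda>v. v \<in> word_class S R w" w])
        (simp add: word_class_def word_eq.refl[OF that])
    then have "word_eq S R w (SOME v. v \<in> word_class S R w)"
      by (simp add: word_class_def)
    from word_val_eq[OF assms this] show ?thesis by (simp only: h_def)
  qed
  then show "\<And>w. w \<in> words S \<Longrightarrow> h (word_class S R w) = word_val f w" .
  have app: "u @ v \<in> words S" if "u \<in> words S" "v \<in> words S" for u v :: "'g word"
    using that by (auto simp: words_def)
  show "h \<in> hom (presented_group S R) G"
  proof (rule homI)
    fix A B assume "A \<in> carrier (presented_group S R)" "B \<in> carrier (presented_group S R)"
    then obtain u v where uv: "u \<in> words S" "v \<in> words S" "A = word_class S R u" "B = word_class S R v"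
      by (auto simp: presented_group_def)
    then show "h (A \<otimes>\<^bsub>presented_group S R\<^esub> B) = h A \<otimes> h B"
      by (simp add: mult_presented_group h app word_val_append[OF assms(1)])
  qed (auto simp: presented_group_def h word_val_closed[OF assms(1)])
qed

section \<open>Normal forms and recognition of dicyclic groups\<close>

lemma dicyclic_conj_pow:
  assumes xy: "x \<in> carrier G" "y \<in> carrier G" and yx: "y \<otimes> x = inv x \<otimes> y"
  shows "y \<otimes> x [^] (i::int) = x [^] (- i) \<otimes> y"
proof -
  \<comment> \<open>Conjugation by \<open>y\<close> is an endomorphism, so its value at
    \<open>x\<close> determines its values at all integer powers.\<close>
  have "(\<lambda>z. y \<otimes> z \<otimes> inv y) \<in> hom G G"
    using xy by (intro homI) (simp_all add: m_assoc inv_solve_left)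
  then interpret c: group_hom G G "\<lambda>z. y \<otimes> z \<otimes> inv y"
    by unfold_locales
  have "y \<otimes> x \<otimes> inv y = inv x" using xy by (simp add: yx m_assoc)
  then have "y \<otimes> x [^] i \<otimes> inv y = x [^] (- i)"
    using c.hom_int_pow[of x i] xy by (simp add: int_pow_neg int_pow_inv)
  then show ?thesis using xy by (metis int_pow_closed m_closed inv_solve_right)
qed

text \<open>The element \<open>x [^] m\<close> is a power of \<open>y\<close>, so it commutes with
  \<open>y\<close>, but conjugation by \<open>y\<close> also inverts it.\<close>

lemma dicyclic_pow_double:
  assumes xy: "x \<in> carrier G" "y \<in> carrier G" and yx: "y \<otimes> x = inv x \<otimes> y"
    and m: "x [^] (m::nat) = y \<otimes> y"
  shows "x [^] (2 * m) = \<one>"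
proof -
  have c: "y \<otimes> x [^] int m = inv (x [^] int m) \<otimes> y"
    using dicyclic_conj_pow[OF xy yx, of "int m"] xy by (simp add: int_pow_neg)
  have "x [^] int m \<otimes> y = y \<otimes> x [^] int m"
    using xy by (simp add: int_pow_int m m_assoc)
  then have "x [^] int m \<otimes> y = inv (x [^] int m) \<otimes> y" by (simp only: c)
  then have "x [^] m = inv (x [^] m)"
    using xy by (metis int_pow_int right_cancel inv_closed nat_pow_closed)
  then have "x [^] m \<otimes> x [^] m = \<one>" using xy by (metis nat_pow_closed r_inv)
  then show ?thesis using xy by (simp add: mult_2 nat_pow_mult)
qed

text \<open>\<open>D\<close> consists of the normal forms in a dicyclic group; its invariance under
  each letter lets any word be reduced by induction.\<close>

lemma dicyclic_step:
  assumes xy: "x \<in> carrier G" "y \<in> carrier G" and yx: "y \<otimes> x = inv x \<otimes> y"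
    and m: "x [^] (m::nat) = y \<otimes> y"
  defines "D \<equiv> {x [^] i | i::int. True} \<union> {x [^] i \<otimes> y | i::int. True}"
  assumes z: "z \<in> D"
  shows "x \<otimes> z \<in> D" "inv x \<otimes> z \<in> D" "y \<otimes> z \<in> D" "inv y \<otimes> z \<in> D"
proof -
  have D: "x [^] i \<in> D" "x [^] i \<otimes> y \<in> D" for i :: int by (auto simp: D_def)
  have xs: "x [^] j \<otimes> z \<in> D" if "z \<in> D" for j :: int and z
    using that xy unfolding D_def by (auto simp: m_assoc[symmetric] simp flip: int_pow_mult)
  show "x \<otimes> z \<in> D" "inv x \<otimes> z \<in> D"
    using xs[OF z, of 1] xs[OF z, of "-1"] xy by (simp_all add: int_pow_neg)
  note c = dicyclic_conj_pow[OF xy yx]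
  have ys: "y \<otimes> z \<in> D" if "z \<in> D" for z
  proof -
    from that obtain i :: int where "z = x [^] i \<or> z = x [^] i \<otimes> y" by (auto simp: D_def)
    moreover have "y \<otimes> (x [^] i \<otimes> y) = x [^] (int m - i)"
    proof -
      have "y \<otimes> (x [^] i \<otimes> y) = x [^] (- i) \<otimes> (y \<otimes> y)"
        using xy by (simp add: m_assoc[symmetric] c)
      also have "\<dots> = x [^] (- i) \<otimes> x [^] int m" by (simp add: m int_pow_int)
      finally show ?thesis using xy by (simp flip: int_pow_mult)
    qed
    ultimately show ?thesis using D by (auto simp: c)
  qed
  show "y \<otimes> z \<in> D" by (rule ys[OF z])
  have zc: "z \<in> carrier G" using z xy by (auto simp: D_def)
  \<comment> \<open>The inverse of \<open>y\<close> is \<open>y \<otimes> x [^] (- int m)\<close>,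
    which reduces this case to the previous ones.\<close>
  have "x [^] (- int m) = inv (y \<otimes> y)" using xy by (simp add: int_pow_neg int_pow_int m)
  then have "inv y \<otimes> z = y \<otimes> (x [^] (- int m) \<otimes> z)"
    using xy zc by (simp add: inv_mult_group m_assoc[symmetric])
  then show "inv y \<otimes> z \<in> D" using ys[OF xs[OF z]] by simp
qed

text \<open>The relations give a homomorphism onto the generated subgroup. Its kernel is read off
  from normal forms: the order of \<open>x\<close> settles the powers of \<open>u\<close>, and the
  other forms cannot become trivial.\<close>

lemma subgroup_generated_iso_dicyclic:
  assumes xy: "x \<in> carrier G" "y \<in> carrier G" and yx: "y \<otimes> x = inv x \<otimes> y"
    and m: "x [^] (m::nat) = y \<otimes> y" and ord: "ord x = 2 * m" and m2: "m \<ge> 2"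
  shows "subgroup_generated G {x, y} \<cong> dicyclic_group m"
proof -
  define R where "R = {(replicate m (pos Dic_x), [pos Dic_y, pos Dic_y]),
      ([pos Dic_y, pos Dic_x, neg Dic_y], [neg Dic_x])}"
  let ?c = "word_class UNIV R" and ?D = "presented_group UNIV R"
  have dic: "dicyclic_group m = ?D" by (simp add: dicyclic_group_def R_def)
  interpret D: group ?D by (rule group_presented_group)
  have w: "w \<in> words UNIV" for w :: "dic_gen word" by (auto simp: words_def)
  define f where "f g = (case g of Dic_x \<Rightarrow> x | Dic_y \<Rightarrow> y)" for g
  have f: "f ` UNIV \<subseteq> carrier G" using xy by (auto simp: f_def split: dic_gen.split)
  have rep: "word_val f (replicate k (pos Dic_x)) = x [^] k" for k
  proof (induction k)
    case (Suc k)
    then show ?case using xy nat_pow_Suc2[OF xy(1), of k] by (simp add: f_def)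
  qed simp
  have "word_val f p = word_val f q" if "(p, q) \<in> R" for p q
  proof -
    have "y \<otimes> (x \<otimes> inv y) = inv x" using xy by (simp add: m_assoc[symmetric] yx) (simp add: m_assoc)
    with that xy m show ?thesis by (auto simp: R_def rep) (simp_all add: f_def)
  qed
  then obtain h where h: "h \<in> hom ?D G" and hw: "\<And>w. h (?c w) = word_val f w"
    using presented_group_hom[OF f, of R] w by metis
  interpret h: group_hom ?D G h using h by unfold_locales
  define u v where "u = ?c [pos Dic_x]" and "v = ?c [pos Dic_y]"
  have uv: "u \<in> carrier ?D" "v \<in> carrier ?D"
    by (simp_all add: u_def v_def word_class_in_carrier w)
  have one: "\<one>\<^bsub>?D\<^esub> = ?c []" by (simp add: presented_group_def)
  have cm: "?c p \<otimes>\<^bsub>?D\<^esub> ?c q = ?c (p @ q)" for p q by (simp add: mult_presented_group w)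
  have hu: "h u = x" "h v = y" using xy by (simp_all add: u_def v_def hw f_def)
  have inv: "?c [neg g] = inv\<^bsub>?D\<^esub> (?c [pos g])" for g
  proof (rule D.inv_equality[symmetric])
    show "?c [neg g] \<otimes>\<^bsub>?D\<^esub> ?c [pos g] = \<one>\<^bsub>?D\<^esub>"
      using word_eq.cancel[of g UNIV R False] by (simp add: cm one word_class_eq_iff w)
  qed (simp_all add: word_class_in_carrier w)
  have um: "u [^]\<^bsub>?D\<^esub> m = v \<otimes>\<^bsub>?D\<^esub> v"
  proof -
    have "u [^]\<^bsub>?D\<^esub> k = ?c (replicate k (pos Dic_x))" for k
      
    proof (induction k)
      case (Suc k)
      then show ?case by (simp only: D.nat_pow_Suc2[OF uv(1)]) (simp add: u_def cm)
    qed (simp add: one)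
    moreover have "word_eq UNIV R (replicate m (pos Dic_x)) [pos Dic_y, pos Dic_y]"
      by (rule word_eq.rel) (simp_all add: R_def w)
    ultimately show ?thesis by (simp add: v_def cm word_class_eq_iff w)
  qed
  have vu: "v \<otimes>\<^bsub>?D\<^esub> u = inv\<^bsub>?D\<^esub> u \<otimes>\<^bsub>?D\<^esub> v"
  proof -
    have "word_eq UNIV R [pos Dic_y, pos Dic_x, neg Dic_y] [neg Dic_x]"
      by (rule word_eq.rel) (simp_all add: R_def w)
    then have "?c [pos Dic_y, pos Dic_x, neg Dic_y] = ?c [neg Dic_x]"
      by (simp add: word_class_eq_iff w)
    then have "v \<otimes>\<^bsub>?D\<^esub> u \<otimes>\<^bsub>?D\<^esub> inv\<^bsub>?D\<^esub> v = inv\<^bsub>?D\<^esub> u"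
      by (simp add: u_def v_def inv[symmetric] cm)
    then show ?thesis using uv by (metis D.inv_solve_right D.inv_closed D.m_closed)
  qed
  let ?N = "{u [^]\<^bsub>?D\<^esub> i | i::int. True} \<union> {u [^]\<^bsub>?D\<^esub> i \<otimes>\<^bsub>?D\<^esub> v | i::int. True}"
  note step = D.dicyclic_step[OF uv vu um]
  have normal_form: "?c w \<in> ?N" for w
  proof (induction w)
    case Nil
    show ?case unfolding one[symmetric] by (metis (mono_tags, lifting) UnI1 int_pow_0 mem_Collect_eq)
  next
    case (Cons l w)
    have "?c (l # w) = ?c [l] \<otimes>\<^bsub>?D\<^esub> ?c w" by (simp add: cm)
    moreover obtain g e where "l = (g, e)" by (cases l)
    ultimately show ?case using step[OF Cons.IH]
      by (cases g; cases e) (simp_all only: inv u_def[symmetric] v_def[symmetric])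
  qed
  have gen: "h ` carrier ?D = generate G {x, y}"
  proof (rule antisym)
    have "word_val f w \<in> generate G {x, y}" for w
    proof (induction w)
      case (Cons l w)
      have "f (fst l) \<in> {x, y}" by (auto simp: f_def split: dic_gen.split)
      then show ?case using Cons by (auto intro: generate.eng generate.incl generate.inv)
    qed (simp add: generate.one)
    then show "h ` carrier ?D \<subseteq> generate G {x, y}" by (auto simp: presented_group_def hw)
    show "generate G {x, y} \<subseteq> h ` carrier ?D"
      using uv hu h.img_is_subgroup by (intro generate_subgroup_incl) blast+
  qed
  have "A = \<one>\<^bsub>?D\<^esub>" if A: "A \<in> carrier ?D" "h A = \<one>" for A
  proof -
    from A normal_form have "A \<in> ?N" by (auto simp: presented_group_def)
    then obtain i :: int where "A = u [^]\<^bsub>?D\<^esub> i \<or> A = u [^]\<^bsub>?D\<^esub> i \<otimes>\<^bsub>?D\<^esub> v" by auto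
    then show ?thesis
    proof
      assume Au: "A = u [^]\<^bsub>?D\<^esub> i"
      then have "x [^] i = \<one>" using A uv by (simp add: h.hom_int_pow hu)
      then have "int (2 * m) dvd i" using ord xy(1) int_pow_eq_id by metis
      moreover have "D.ord u dvd 2 * m"
        using D.dicyclic_pow_double[OF uv vu um] D.pow_eq_id[OF uv(1)] by simp
      ultimately have "int (D.ord u) dvd i" by (meson dvd_trans int_dvd_int_iff)
      then show ?thesis using Au D.int_pow_eq_id[OF uv(1)] by simp
    next
      assume "A = u [^]\<^bsub>?D\<^esub> i \<otimes>\<^bsub>?D\<^esub> v"
      then have "x [^] i \<otimes> y = \<one>" using A uv by (simp add: h.hom_int_pow hu)
      \<comment> \<open>Here \<open>y\<close> would commute with \<open>x\<close>, which makes
        \<open>x\<close> its own inverse, against \<open>ord x = 2 * m\<close> and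
        \<open>m \<ge> 2\<close>.\<close>
      then have "y = x [^] (- i)" using xy by (metis int_pow_closed int_pow_neg inv_equality inv_inv)
      moreover have "x [^] (- i) \<otimes> x [^] (1::int) = x [^] (1::int) \<otimes> x [^] (- i)"
        using xy by (simp only: int_pow_mult[symmetric] add.commute)
      ultimately have "x \<otimes> y = inv x \<otimes> y" using yx xy by (metis int_pow_1)
      then have "x = inv x" using xy by (metis right_cancel inv_closed)
      then have "x \<otimes> x = \<one>" using xy by (metis r_inv)
      then have "x [^] (2::nat) = \<one>" using xy by (simp add: numeral_2_eq_2)
      then have "2 * m dvd 2" using xy(1) ord pow_eq_id by metis
      then show ?thesis using m2 by (auto dest: dvd_imp_le)
    qed
  qed
  then have inj: "inj_on h (carrier ?D)" using h.inj_on_one_iff by blast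
  have "h \<in> iso ?D (subgroup_generated G {x, y})"
  proof (rule isoI)
    have c: "carrier (subgroup_generated G {x, y}) = generate G {x, y}"
      using xy by (simp add: carrier_subgroup_generated)
    show "bij_betw h (carrier ?D) (carrier (subgroup_generated G {x, y}))"
      using inj gen by (simp add: bij_betw_def c)
    show "h \<in> hom ?D (subgroup_generated G {x, y})"
      using h gen by (auto simp: hom_def c)
  qed
  then have "?D \<cong> subgroup_generated G {x, y}" by (rule is_isoI)
  then show ?thesis unfolding dic by (rule D.iso_sym)
qed

end

section \<open>Relations in the braid groups\<close>

text \<open>
  Indices start at \<open>0\<close>: \<open>s i\<close> and \<open>r i\<close> are the generators \<open>\<sigma>\<^sub>i\<^sub>+\<^sub>1\<close> and \<open>\<rho>\<^sub>i\<^sub>+\<^sub>1\<close>, and \<open>N = n - 1\<close>.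
  The surface relation is only imposed in \<open>RP2_braids\<close> below. The inverses in the other relations
  are cleared, and \<open>s\<close> and \<open>r\<close> are total with values in \<open>G\<close>, so that no index side
  conditions appear in closure arguments.
\<close>

locale projective_braids = group G for G (structure) +
  fixes s r :: "nat \<Rightarrow> 'a" and N :: nat
  assumes s_closed [simp, intro]: "s i \<in> carrier G"
    and r_closed [simp, intro]: "r i \<in> carrier G"
    and far: "Suc i < j \<Longrightarrow> j < N \<Longrightarrow> s i \<otimes> s j = s j \<otimes> s i"
    and braid: "Suc i < N \<Longrightarrow> s i \<otimes> (s (Suc i) \<otimes> s i) = s (Suc i) \<otimes> (s i \<otimes> s (Suc i))"
    and s_r: "i < N \<Longrightarrow> j \<le> N \<Longrightarrow> j \<noteq> i \<Longrightarrow> j \<noteq> Suc i \<Longrightarrow> s i \<otimes> r j = r j \<otimes> s i"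
    and r_Suc: "i < N \<Longrightarrow> s i \<otimes> (r (Suc i) \<otimes> s i) = r i"
    and r_r: "i < N \<Longrightarrow> r (Suc i) \<otimes> r i = r i \<otimes> (r (Suc i) \<otimes> (s i \<otimes> s i))"
begin

text \<open>Allows an equation for \<open>x \<otimes> y\<close> to rewrite inside products that are
  associated to the right.\<close>

lemma assoc_rule:
  assumes "x \<otimes> y = z" "x \<in> carrier G" "y \<in> carrier G" "t \<in> carrier G"
  shows "x \<otimes> (y \<otimes> t) = z \<otimes> t"
  using assms by (metis m_assoc)

text \<open>
  \<open>half_twist k\<close> is \<open>\<Delta>\<^sub>k\<^sub>+\<^sub>1\<close>, and \<open>alpha k\<close> is the element \<open>a\<close> on the first \<open>k + 1\<close> strands;
  thus \<open>a = alpha N\<close> and \<open>b = alpha (N - 1)\<close>.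
\<close>

primrec up where "up 0 = \<one>" | "up (Suc k) = up k \<otimes> s k"
primrec down where "down 0 = \<one>" | "down (Suc k) = s k \<otimes> down k"
primrec half_twist where
  "half_twist 0 = \<one>" | "half_twist (Suc k) = up (Suc k) \<otimes> half_twist k"
primrec rho_prod where "rho_prod 0 = r 0" | "rho_prod (Suc k) = r (Suc k) \<otimes> rho_prod k"
definition alpha where "alpha k = r k \<otimes> down k"

lemma closed [simp, intro]:
  "up k \<in> carrier G" "down k \<in> carrier G" "half_twist k \<in> carrier G"
  "rho_prod k \<in> carrier G" "alpha k \<in> carrier G"
  by (induction k) (auto simp: alpha_def)

section \<open>Shift relations and the powers of \<open>alpha\<close>\<close>

lemma up_commute:
  assumes "x \<in> carrier G" "\<And>i. i < k \<Longrightarrow> s i \<otimes> x = x \<otimes> s i"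
  shows "up k \<otimes> x = x \<otimes> up k"
  using assms(2)
proof (induction k)
  case (Suc k)
  then have c: "s k \<otimes> x = x \<otimes> s k" and u: "up k \<otimes> x = x \<otimes> up k" by simp_all
  show ?case using assms(1) by (simp add: m_assoc c assoc_rule[OF u])
qed (use assms(1) in auto)

lemma down_commute:
  assumes "x \<in> carrier G" "\<And>i. i < k \<Longrightarrow> s i \<otimes> x = x \<otimes> s i"
  shows "down k \<otimes> x = x \<otimes> down k"
  using assms(2)
proof (induction k)
  case (Suc k)
  then have c: "s k \<otimes> x = x \<otimes> s k" and d: "down k \<otimes> x = x \<otimes> down k" by simp_all
  show ?case using assms(1) by (simp add: m_assoc d assoc_rule[OF c])
qed (use assms(1) in auto)

text \<open>By \<open>r_Suc\<close> the product telescopes from its centre.\<close>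

lemma up_r_down: "k \<le> N \<Longrightarrow> up k \<otimes> (r k \<otimes> down k) = r 0"
proof (induction k)
  case (Suc k)
  have "up (Suc k) \<otimes> (r (Suc k) \<otimes> down (Suc k))
      = up k \<otimes> (s k \<otimes> (r (Suc k) \<otimes> s k) \<otimes> down k)" by (simp add: m_assoc)
  with Suc show ?case by (simp add: r_Suc)
qed auto

lemma up_alpha: "k \<le> N \<Longrightarrow> up k \<otimes> alpha k = r 0"
  by (simp add: alpha_def up_r_down)

text \<open>The form in which \<open>a\<close> and \<open>b\<close> are given originally; the
  definition of \<open>alpha\<close> avoids inverses.\<close>

lemma alpha_eq: "k \<le> N \<Longrightarrow> alpha k = inv (up k) \<otimes> r 0"
  by (metis closed(1,5) r_closed inv_solve_left' up_alpha)

lemma s_alpha_Suc: "k < N \<Longrightarrow> s k \<otimes> alpha (Suc k) = alpha k"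
  using r_Suc[of k, THEN assoc_rule[of _ _ _ "down k"]] by (simp add: alpha_def m_assoc)

text \<open>The letter \<open>s i\<close> moves left until it meets
  \<open>s i \<otimes> s (Suc i)\<close>, is changed by the braid relation, and then moves on to the
  left end.\<close>

lemma up_s: "Suc i < k \<Longrightarrow> k \<le> N \<Longrightarrow> up k \<otimes> s i = s (Suc i) \<otimes> up k"
proof (induction k)
  case (Suc k)
  show ?case
  proof (cases "Suc i = k")
    case True
    have u: "up i \<otimes> s (Suc i) = s (Suc i) \<otimes> up i"
      using Suc.prems True by (intro up_commute far) auto
    have "up (Suc k) \<otimes> s i = up i \<otimes> (s i \<otimes> (s (Suc i) \<otimes> s i))"
      by (simp add: True[symmetric] m_assoc)
    also have "\<dots> = up i \<otimes> (s (Suc i) \<otimes> (s i \<otimes> s (Suc i)))"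
      using braid[of i] Suc.prems True by simp
    also have "\<dots> = s (Suc i) \<otimes> up (Suc k)"
      by (simp add: True[symmetric] m_assoc assoc_rule[OF u])
    finally show ?thesis .
  next
    case False
    then have "up k \<otimes> s i = s (Suc i) \<otimes> up k" "s i \<otimes> s k = s k \<otimes> s i"
      using Suc by (auto intro: far)
    then show ?thesis by (simp add: m_assoc) (metis assoc_rule closed(1) s_closed m_assoc)
  qed
qed auto

lemma down_s: "Suc i < k \<Longrightarrow> k \<le> N \<Longrightarrow> down k \<otimes> s (Suc i) = s i \<otimes> down k"
proof (induction k)
  case (Suc k)
  show ?case
  proof (cases "Suc i = k")
    case True
    have u: "down i \<otimes> s (Suc i) = s (Suc i) \<otimes> down i"
      using Suc.prems True by (intro down_commute far) auto
    have "down (Suc k) \<otimes> s (Suc i) = s (Suc i) \<otimes> (s i \<otimes> s (Suc i)) \<otimes> down i"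
      by (simp add: True[symmetric] m_assoc u)
    also have "\<dots> = s i \<otimes> (s (Suc i) \<otimes> s i) \<otimes> down i"
      using braid[of i] Suc.prems True by simp
    also have "\<dots> = s i \<otimes> down (Suc k)"
      by (simp add: True[symmetric] m_assoc)
    finally show ?thesis .
  next
    case False
    then have "down k \<otimes> s (Suc i) = s i \<otimes> down k" "s i \<otimes> s k = s k \<otimes> s i"
      using Suc by (auto intro: far)
    then show ?thesis by (simp add: m_assoc) (metis assoc_rule closed(2) s_closed m_assoc)
  qed
qed auto

lemma alpha_s:
  assumes "Suc i < k" "k \<le> N"
  shows "s i \<otimes> alpha k = alpha k \<otimes> s (Suc i)"
  using assms by (simp add: alpha_def m_assoc down_s assoc_rule[OF s_r])

text \<open>Below the top index, multiplication by \<open>s k\<close> turns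
  \<open>alpha (Suc k)\<close> into \<open>alpha k\<close>, and induction applies; the top index
  needs \<open>r_r\<close>.\<close>

lemma alpha_r: "i < k \<Longrightarrow> k \<le> N \<Longrightarrow> r i \<otimes> alpha k = alpha k \<otimes> r (Suc i)"
proof (induction k)
  case (Suc k)
  show ?case
  proof (cases "i = k")
    case True
    have d: "down k \<otimes> r (Suc k) = r (Suc k) \<otimes> down k"
      using Suc.prems by (intro down_commute) (auto simp: s_r)
    \<comment> \<open>Both sides are \<open>r (Suc k) \<otimes> r k\<close>, on the left by
      \<open>r_r\<close> and on the right by \<open>r_Suc\<close>.\<close>
    have "(r k \<otimes> (r (Suc k) \<otimes> s k)) \<otimes> s k = (r (Suc k) \<otimes> (s k \<otimes> r (Suc k))) \<otimes> s k"
      using Suc.prems by (simp add: m_assoc r_r[symmetric] r_Suc)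
    then have e: "r k \<otimes> (r (Suc k) \<otimes> s k) = r (Suc k) \<otimes> (s k \<otimes> r (Suc k))" by simp
    have "r k \<otimes> alpha (Suc k) = r k \<otimes> (r (Suc k) \<otimes> s k) \<otimes> down k"
      by (simp add: alpha_def m_assoc)
    also have "\<dots> = alpha (Suc k) \<otimes> r (Suc k)"
      by (simp only: e) (simp add: alpha_def m_assoc d)
    finally show ?thesis using True by simp
  next
    case False
    then have IH: "r i \<otimes> alpha k = alpha k \<otimes> r (Suc i)" and c: "s k \<otimes> r i = r i \<otimes> s k"
      and a: "s k \<otimes> alpha (Suc k) = alpha k"
      using Suc by (auto simp: s_r s_alpha_Suc)
    have "s k \<otimes> (r i \<otimes> alpha (Suc k)) = s k \<otimes> (alpha (Suc k) \<otimes> r (Suc i))"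
      by (simp add: assoc_rule[OF c] assoc_rule[OF a] m_assoc a IH)
    then show ?thesis by simp
  qed
qed auto

text \<open>Stated for an arbitrary family, to serve for both \<open>s\<close> and
  \<open>r\<close>.\<close>

lemma shift_pow:
  assumes x: "x \<in> carrier G" and f: "\<And>i. f i \<in> carrier G"
    and c: "\<And>i. i < k \<Longrightarrow> f i \<otimes> x = x \<otimes> f (Suc i)"
  shows "i + j \<le> k \<Longrightarrow> f i \<otimes> x [^] j = x [^] j \<otimes> f (i + j)"
proof (induction j)
  case (Suc j)
  then have IH: "f i \<otimes> x [^] j = x [^] j \<otimes> f (i + j)" by simp
  show ?case using Suc.prems x f
    by (simp add: assoc_rule[OF IH] c m_assoc)
qed (use x f in auto)

text \<open>Each letter of \<open>down j\<close> is carried through a power of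
  \<open>alpha (Suc k)\<close> until it is \<open>s k\<close>; there it turns one factor
  \<open>alpha (Suc k)\<close> into \<open>alpha k\<close>.\<close>

lemma down_alpha_pow:
  assumes "k < N" "j \<le> Suc k"
  shows "down j \<otimes> alpha (Suc k) [^] Suc k = alpha (Suc k) [^] (Suc k - j) \<otimes> alpha k [^] j"
  using assms(2)
proof (induction j)
  case (Suc j)
  let ?x = "alpha (Suc k)"
  have "s j \<otimes> ?x [^] (k - j) = ?x [^] (k - j) \<otimes> s (j + (k - j))"
    using assms Suc by (intro shift_pow[where k=k]) (auto simp: alpha_s)
  then have c: "s j \<otimes> ?x [^] (k - j) = ?x [^] (k - j) \<otimes> s k" using Suc by simp
  have "Suc k - j = Suc (k - j)" using Suc by simp
  then have p: "?x [^] (Suc k - j) = ?x [^] (k - j) \<otimes> ?x" by simp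
  have "down (Suc j) \<otimes> ?x [^] Suc k = s j \<otimes> (?x [^] (k - j) \<otimes> ?x) \<otimes> alpha k [^] j"
    using Suc by (simp del: nat_pow_Suc add: m_assoc p)
  also have "\<dots> = ?x [^] (k - j) \<otimes> (s k \<otimes> ?x) \<otimes> alpha k [^] j"
    by (simp add: m_assoc assoc_rule[OF c])
  also have "\<dots> = ?x [^] (Suc k - Suc j) \<otimes> alpha k [^] Suc j"
    by (simp only: s_alpha_Suc[OF assms(1)] nat_pow_Suc2[OF closed(5)] diff_Suc_Suc) (simp add: m_assoc)
  finally show ?case .
qed auto

lemma alpha_pow: "k \<le> N \<Longrightarrow> alpha k [^] Suc k = rho_prod k"
proof (induction k)
  case 0
  then show ?case by (simp add: alpha_def)
next
  case (Suc k)
  have "alpha (Suc k) [^] Suc (Suc k) = r (Suc k) \<otimes> (down (Suc k) \<otimes> alpha (Suc k) [^] Suc k)"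
    by (subst nat_pow_Suc2) (simp_all del: nat_pow_Suc add: alpha_def m_assoc)
  also have "\<dots> = r (Suc k) \<otimes> alpha k [^] Suc k"
    using Suc.prems by (subst down_alpha_pow) (auto)
  finally show ?case using Suc by simp
qed

section \<open>The half twist and conjugation by it\<close>

lemma half_twist_commute:
  assumes "x \<in> carrier G" "\<And>i. i < k \<Longrightarrow> s i \<otimes> x = x \<otimes> s i"
  shows "half_twist k \<otimes> x = x \<otimes> half_twist k"
  using assms(2)
proof (induction k)
  case (Suc k)
  have u: "up (Suc k) \<otimes> x = x \<otimes> up (Suc k)" using Suc assms by (intro up_commute) auto
  from Suc have "half_twist k \<otimes> x = x \<otimes> half_twist k" by simp
  then show ?case using assms(1) by (simp add: m_assoc del: up.simps) (simp add: assoc_rule[OF u] m_assoc del: up.simps)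
qed (use assms(1) in auto)

text \<open>The mirror image of the defining recursion; \<open>s (Suc k)\<close> only has to pass
  \<open>half_twist k\<close>.\<close>

lemma half_twist_Suc': "Suc k \<le> N \<Longrightarrow> half_twist (Suc k) = half_twist k \<otimes> down (Suc k)"
proof (induction k)
  case (Suc k)
  have c: "half_twist k \<otimes> s (Suc k) = s (Suc k) \<otimes> half_twist k"
    using Suc.prems by (intro half_twist_commute far) auto
  have "half_twist (Suc (Suc k)) = up (Suc k) \<otimes> (s (Suc k) \<otimes> half_twist k) \<otimes> down (Suc k)"
    using Suc by (simp add: m_assoc)
  also have "\<dots> = half_twist (Suc k) \<otimes> down (Suc (Suc k))"
    by (simp only: c[symmetric]) (simp add: m_assoc)
  finally show ?case .
qed auto

text \<open>The recursion at the left end treats \<open>i < k\<close>; the last generator needs the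
  one at the right end.\<close>

lemma half_twist_s: "i < k \<Longrightarrow> k \<le> N \<Longrightarrow> half_twist k \<otimes> s i = s (k - Suc i) \<otimes> half_twist k"
proof (induction k arbitrary: i)
  case (Suc k)
  show ?case
  proof (cases "i < k")
    case True
    then have IH: "half_twist k \<otimes> s i = s (k - Suc i) \<otimes> half_twist k" using Suc by simp
    have u: "up (Suc k) \<otimes> s (k - Suc i) = s (Suc (k - Suc i)) \<otimes> up (Suc k)"
      using Suc True by (intro up_s) auto
    have e: "Suc (k - Suc i) = k - i" using True by simp
    show ?thesis by (simp add: m_assoc IH del: up.simps)
      (simp add: assoc_rule[OF u] m_assoc e del: up.simps)
  next
    case False
    then have i: "i = k" using Suc by simp
    show ?thesis
    proof (cases k)
      case 0
      then show ?thesis using i by simp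
    next
      case (Suc l)
      have IH: "half_twist k \<otimes> s l = s 0 \<otimes> half_twist k"
        using Suc.IH[of l] Suc Suc.prems \<open>k = Suc l\<close> by simp
      have d: "down (Suc k) \<otimes> s k = s l \<otimes> down (Suc k)"
        using Suc.prems Suc by (simp only: Suc) (rule down_s, auto)
      show ?thesis using Suc.prems i
        by (simp only: half_twist_Suc' i) (simp add: m_assoc d assoc_rule[OF IH] del: down.simps)
    qed
  qed
qed auto


text \<open>
  \<open>loop k\<close> takes strand \<open>n - k\<close> once around the last \<open>k\<close> strands. Both the full twist and the
  square of \<open>\<rho>\<^sub>n \<dots> \<rho>\<^sub>1\<close> are the product of all of these.
\<close>

primrec loop where
  "loop 0 = \<one>" | "loop (Suc k) = s (N - Suc k) \<otimes> (loop k \<otimes> s (N - Suc k))"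
primrec loops where
  "loops 0 = \<one>" | "loops (Suc k) = loops k \<otimes> loop (Suc k)"

section \<open>The full twist as a product of loops\<close>

lemma loop_closed [simp, intro]: "loop k \<in> carrier G" "loops k \<in> carrier G"
proof -
  show "loop k \<in> carrier G" for k by (induction k) auto
  then show "loops k \<in> carrier G" by (induction k) auto
qed

text \<open>Reversal of the indices turns the palindrome \<open>down k \<otimes> up k\<close> into
  the palindrome \<open>loop k\<close>.\<close>

lemma half_twist_down_up:
  "k \<le> N \<Longrightarrow> half_twist N \<otimes> (down k \<otimes> up k) = loop k \<otimes> half_twist N"
proof (induction k)
  case (Suc k)
  have IH: "half_twist N \<otimes> (down k \<otimes> up k) = loop k \<otimes> half_twist N" using Suc by simp
  have c: "half_twist N \<otimes> s k = s (N - Suc k) \<otimes> half_twist N"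
    using Suc.prems by (simp add: half_twist_s)
  have "half_twist N \<otimes> (down (Suc k) \<otimes> up (Suc k))
      = half_twist N \<otimes> s k \<otimes> (down k \<otimes> up k) \<otimes> s k" by (simp add: m_assoc)
  also have "\<dots> = s (N - Suc k) \<otimes> (half_twist N \<otimes> (down k \<otimes> up k)) \<otimes> s k"
    by (simp only: c) (simp add: m_assoc)
  also have "\<dots> = s (N - Suc k) \<otimes> loop k \<otimes> (half_twist N \<otimes> s k)"
    by (simp only: IH) (simp add: m_assoc)
  also have "\<dots> = loop (Suc k) \<otimes> half_twist N"
    by (simp only: c) (simp add: m_assoc)
  finally show ?case .
qed auto

text \<open>The two recursions put \<open>down (Suc k) \<otimes> up (Suc k)\<close> between two
  copies of \<open>half_twist k\<close>. This loop of the last strand around the others commutes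
  with every \<open>s i\<close> for \<open>i < k\<close>.\<close>

lemma half_twist_sq_Suc:
  assumes "Suc k \<le> N"
  shows "half_twist (Suc k) \<otimes> half_twist (Suc k)
    = half_twist k \<otimes> half_twist k \<otimes> (down (Suc k) \<otimes> up (Suc k))"
proof -
  let ?A = "down (Suc k) \<otimes> up (Suc k)"
  have "s i \<otimes> ?A = ?A \<otimes> s i" if "i < k" for i
  proof -
    have "s i \<otimes> ?A = down (Suc k) \<otimes> (s (Suc i) \<otimes> up (Suc k))"
      using down_s[of i "Suc k"] that assms by (simp add: m_assoc[symmetric] del: down.simps up.simps)
    also have "\<dots> = ?A \<otimes> s i"
      using up_s[of i "Suc k"] that assms by (simp add: m_assoc del: down.simps up.simps)
    finally show ?thesis .
  qed
  then have c: "half_twist k \<otimes> ?A = ?A \<otimes> half_twist k"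
    by (intro half_twist_commute) auto
  have "half_twist (Suc k) \<otimes> half_twist (Suc k)
      = (half_twist k \<otimes> down (Suc k)) \<otimes> (up (Suc k) \<otimes> half_twist k)"
    using half_twist_Suc'[OF assms] by simp
  also have "\<dots> = half_twist k \<otimes> (?A \<otimes> half_twist k)"
    by (simp add: m_assoc del: down.simps up.simps)
  also have "\<dots> = half_twist k \<otimes> half_twist k \<otimes> ?A"
    by (simp only: c[symmetric]) (simp add: m_assoc del: down.simps up.simps)
  finally show ?thesis .
qed

lemma half_twist_loops:
  "k \<le> N \<Longrightarrow> half_twist N \<otimes> (half_twist k \<otimes> half_twist k) = loops k \<otimes> half_twist N"
proof (induction k)
  case (Suc k)
  have IH: "half_twist N \<otimes> (half_twist k \<otimes> half_twist k) = loops k \<otimes> half_twist N" using Suc by simp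
  have "half_twist N \<otimes> (half_twist (Suc k) \<otimes> half_twist (Suc k))
      = half_twist N \<otimes> (half_twist k \<otimes> half_twist k) \<otimes> (down (Suc k) \<otimes> up (Suc k))"
    by (simp only: half_twist_sq_Suc[OF Suc.prems]) (simp add: m_assoc)
  also have "\<dots> = loops k \<otimes> (half_twist N \<otimes> (down (Suc k) \<otimes> up (Suc k)))"
    by (simp only: IH) (simp add: m_assoc)
  also have "\<dots> = loops (Suc k) \<otimes> half_twist N"
    by (simp only: half_twist_down_up[OF Suc.prems]) (simp add: m_assoc del: loop.simps)
  finally show ?case .
qed auto

lemma half_twist_sq: "half_twist N \<otimes> half_twist N = loops N"
proof -
  have "(half_twist N \<otimes> half_twist N) \<otimes> half_twist N = loops N \<otimes> half_twist N"
    using half_twist_loops[of N] by (simp add: m_assoc)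
  then show ?thesis by simp
qed

lemma half_twist_down: "half_twist N \<otimes> down N = up N \<otimes> half_twist N"
proof (cases N)
  case (Suc k)
  have "half_twist N \<otimes> down N = up N \<otimes> (half_twist k \<otimes> down N)"
    by (simp add: Suc m_assoc)
  also have "\<dots> = up N \<otimes> half_twist N"
    by (simp only: Suc half_twist_Suc'[of k, symmetric])
  finally show ?thesis .
qed simp

lemma up_loop_down: "k \<le> N \<Longrightarrow> up k \<otimes> (loop (N - k) \<otimes> down k) = loop N"
proof (induction k)
  case (Suc k)
  then have e: "N - k = Suc (N - Suc k)" "N - Suc (N - Suc k) = k" by auto
  have "up (Suc k) \<otimes> (loop (N - Suc k) \<otimes> down (Suc k)) = up k \<otimes> (loop (N - k) \<otimes> down k)"
    by (simp add: e(1) m_assoc) (simp add: e(2))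
  then show ?case using Suc by simp
qed auto
end

section \<open>Consequences of the surface relation\<close>

locale RP2_braids = projective_braids +
  assumes N_pos: "0 < N" and r_sq: "r 0 \<otimes> r 0 = up N \<otimes> down N"
begin

text \<open>The surface relation and \<open>up_r_down\<close> give
  \<open>r 0 \<otimes> (up N \<otimes> r N) = up N\<close>. Since \<open>r N\<close> commutes with
  \<open>half_twist (N - 1)\<close>, the same holds with \<open>half_twist N\<close> for
  \<open>up N\<close>.\<close>

lemma alpha_half_twist: "alpha N \<otimes> (half_twist N \<otimes> alpha N) = half_twist N"
proof -
  obtain k where k: "N = Suc k" using N_pos by (cases N) auto
  have "r 0 \<otimes> (up N \<otimes> r N) \<otimes> down N = r 0 \<otimes> r 0" using up_r_down[of N] by (simp add: m_assoc)
  also have "\<dots> = up N \<otimes> down N" by (rule r_sq)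
  finally have "r 0 \<otimes> (up N \<otimes> r N) = up N" by simp
  moreover have "half_twist k \<otimes> r N = r N \<otimes> half_twist k"
    using k by (intro half_twist_commute) (auto simp: s_r)
  ultimately have h: "r 0 \<otimes> (half_twist N \<otimes> r N) = half_twist N"
    by (simp add: k m_assoc del: up.simps) (simp add: m_assoc[symmetric] del: up.simps)
  have "up N \<otimes> (alpha N \<otimes> (half_twist N \<otimes> alpha N)) = r 0 \<otimes> (half_twist N \<otimes> r N) \<otimes> down N"
    by (simp add: m_assoc[symmetric] up_alpha) (simp add: alpha_def m_assoc)
  also have "\<dots> = up N \<otimes> half_twist N" by (simp only: h half_twist_down)
  finally show ?thesis by simp
qed

lemma loop_N: "loop N = r 0 \<otimes> r 0"
  using up_loop_down[of N] by (simp add: r_sq)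

text \<open>Multiplication by \<open>up (Suc k)\<close> produces two factors \<open>r 0\<close>, the
  second after a shift through a power of \<open>alpha (Suc k)\<close>. Their product is
  \<open>loop N\<close>, from which \<open>up_loop_down\<close> extracts the smaller loop.\<close>

lemma rho_prod_sq_Suc:
  assumes "Suc k \<le> N"
  shows "rho_prod (Suc k) \<otimes> rho_prod (Suc k) = loop (N - Suc k) \<otimes> (rho_prod k \<otimes> rho_prod k)"
proof -
  let ?m = "Suc k" and ?x = "alpha (Suc k) [^] Suc k"
  have x: "?x \<in> carrier G" by simp
  have P: "rho_prod k = down ?m \<otimes> ?x"
    using assms by (subst down_alpha_pow) (auto simp: alpha_pow[symmetric] simp del: nat_pow_Suc)
  have "r 0 \<otimes> ?x = ?x \<otimes> r (0 + Suc k)"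
    using assms by (intro shift_pow[where k="Suc k"]) (auto simp: alpha_r)
  then have c: "?x \<otimes> r ?m = r 0 \<otimes> ?x" by simp
  have "up ?m \<otimes> (rho_prod ?m \<otimes> rho_prod ?m)
      = up ?m \<otimes> (r ?m \<otimes> down ?m) \<otimes> (?x \<otimes> r ?m) \<otimes> rho_prod k"
    using x by (simp del: nat_pow_Suc up.simps down.simps add: m_assoc P)
  also have "\<dots> = r 0 \<otimes> r 0 \<otimes> (?x \<otimes> rho_prod k)"
    using x by (simp only: c up_r_down[OF assms]) (simp del: nat_pow_Suc add: m_assoc)
  also have "\<dots> = up ?m \<otimes> (loop (N - ?m) \<otimes> (down ?m \<otimes> ?x)) \<otimes> rho_prod k"
    using x by (simp only: loop_N[symmetric] up_loop_down[OF assms, symmetric])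
      (simp del: nat_pow_Suc up.simps down.simps add: m_assoc)
  also have "\<dots> = up ?m \<otimes> (loop (N - ?m) \<otimes> (rho_prod k \<otimes> rho_prod k))"
    by (simp only: P[symmetric]) (simp del: up.simps add: m_assoc)
  finally show ?thesis by (simp del: up.simps rho_prod.simps)
qed

lemma rho_prod_sq_loops:
  assumes "k < N"
  shows "rho_prod (N - 1) \<otimes> rho_prod (N - 1) = loops k \<otimes> (rho_prod (N - 1 - k) \<otimes> rho_prod (N - 1 - k))"
  using assms
proof (induction k)
  case (Suc k)
  then have e: "N - 1 - k = Suc (N - 1 - Suc k)" "N - Suc (N - 1 - Suc k) = Suc k" by auto
  have "rho_prod (N - 1 - k) \<otimes> rho_prod (N - 1 - k)
      = loop (Suc k) \<otimes> (rho_prod (N - 1 - Suc k) \<otimes> rho_prod (N - 1 - Suc k))"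
    unfolding e(1) using Suc.prems by (subst rho_prod_sq_Suc) (simp_all add: e(2) del: loop.simps)
  then show ?case using Suc by (simp add: m_assoc del: loop.simps)
qed simp

text \<open>Once all smaller loops are split off, \<open>r 0 \<otimes> r 0\<close> remains, and this
  is the last factor \<open>loop N\<close> of the full twist.\<close>

lemma rho_prod_pred_sq: "rho_prod (N - 1) \<otimes> rho_prod (N - 1) = half_twist N \<otimes> half_twist N"
proof -
  obtain k where k: "N = Suc k" using N_pos by (cases N) auto
  have "loops (Suc k) = loops k \<otimes> loop (Suc k)" by (rule loops.simps)
  then have "loops N = loops k \<otimes> loop N" by (simp only: k)
  moreover have "k < N" "N - Suc k = 0" using k by simp_all
  ultimately show ?thesis using rho_prod_sq_loops[of k] by (simp add: half_twist_sq loop_N)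
qed

lemma rho_prod_sq: "rho_prod N \<otimes> rho_prod N = half_twist N \<otimes> half_twist N"
  using rho_prod_sq_Suc[of "N - 1"] N_pos by (simp add: rho_prod_pred_sq[simplified])

lemma alpha_pow_eq: "alpha N [^] (2 * Suc N) = half_twist N \<otimes> half_twist N"
  using alpha_pow[of N] by (simp only: mult_2 nat_pow_mult[OF closed(5), symmetric] rho_prod_sq order_refl)

lemma alpha_pred_pow_eq: "alpha (N - 1) [^] (2 * N) = half_twist N \<otimes> half_twist N"
proof -
  have "alpha (N - 1) [^] N = rho_prod (N - 1)" using alpha_pow[of "N - 1"] N_pos by simp
  then show ?thesis by (simp only: mult_2 nat_pow_mult[OF closed(5), symmetric] rho_prod_pred_sq)
qed

text \<open>Only the two leftmost factors of \<open>rho_prod N\<close> interact with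
  \<open>s (N - 1)\<close>; for them \<open>r_Suc\<close> and \<open>r_r\<close> combine.\<close>

lemma s_rho_prod: "s (N - 1) \<otimes> (rho_prod N \<otimes> s (N - 1)) = rho_prod N"
proof -
  obtain k where k: "N = Suc k" using N_pos by (cases N) auto
  \<comment> \<open>The remaining factors; there are none for two strands, where
    \<open>k = 0\<close>.\<close>
  define t where "t = (if k = 0 then \<one> else rho_prod (k - 1))"
  have t [simp]: "t \<in> carrier G" by (simp add: t_def)
  have c: "rho_prod j \<otimes> s k = s k \<otimes> rho_prod j" if "j < k" for j
    using that
  proof (induction j)
    case (Suc j)
    then have IH: "rho_prod j \<otimes> s k = s k \<otimes> rho_prod j" and e: "s k \<otimes> r (Suc j) = r (Suc j) \<otimes> s k"
      using k by (auto simp: s_r)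
    show ?case by (simp add: m_assoc IH assoc_rule[OF e])
  qed (use k in \<open>auto simp: s_r\<close>)
  have tc: "t \<otimes> s k = s k \<otimes> t" using c[of "k - 1"] by (auto simp: t_def)
  have P: "rho_prod N = r (Suc k) \<otimes> (r k \<otimes> t)" unfolding t_def k by (cases k) (auto)
  have S: "s k \<otimes> (r (Suc k) \<otimes> s k) = r k" using r_Suc[of k] k by simp
  have "s k \<otimes> (r (Suc k) \<otimes> (r k \<otimes> s k)) = s k \<otimes> (r (Suc k) \<otimes> s k) \<otimes> (r (Suc k) \<otimes> (s k \<otimes> s k))"
    by (subst S[symmetric]) (simp add: m_assoc)
  also have "\<dots> = r (Suc k) \<otimes> r k" using r_r[of k] k by (simp only: S)
  finally have "s k \<otimes> (r (Suc k) \<otimes> (r k \<otimes> s k)) = r (Suc k) \<otimes> r k" .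
  then show ?thesis unfolding P by (simp add: k m_assoc tc) (simp add: m_assoc[symmetric])
qed

text \<open>As \<open>b\<close> is \<open>s (N - 1) \<otimes> a\<close>, moving the second
  \<open>s (N - 1)\<close> through the half twist to become \<open>s 0\<close> reduces the claim to
  \<open>e\<close> below and \<open>alpha_half_twist\<close>.\<close>

lemma alpha_pred_half_twist:
  defines "c \<equiv> alpha N \<otimes> half_twist N"
  shows "alpha (N - 1) \<otimes> (c \<otimes> alpha (N - 1)) = c"
proof -
  obtain k where k: "N = Suc k" using N_pos by (cases N) auto
  let ?a = "alpha N"
  have b: "alpha k = s k \<otimes> ?a" using s_alpha_Suc[of k] k by simp
  \<comment> \<open>Two factors are split off because exactly \<open>?a [^] k\<close> carries
    \<open>s 0\<close> to \<open>s k\<close>, where \<open>s_rho_prod\<close> applies.\<close>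
  have pw: "?a \<otimes> (?a \<otimes> ?a [^] k) = rho_prod N" "?a [^] k \<in> carrier G"
    using alpha_pow[of N] by (simp_all only: k nat_pow_Suc2 closed nat_pow_closed order_refl)
  have "s 0 \<otimes> ?a [^] k = ?a [^] k \<otimes> s (0 + k)"
    by (rule shift_pow[where k = k]) (auto simp: alpha_s k)
  then have sk: "s 0 \<otimes> ?a [^] k = ?a [^] k \<otimes> s k" by simp
  have nk: "N - 1 = k" using k by simp
  have "s k \<otimes> (?a \<otimes> (?a \<otimes> s 0)) \<otimes> ?a [^] k = s k \<otimes> (?a \<otimes> (?a \<otimes> ?a [^] k) \<otimes> s k)"
    using pw(2) by (simp add: m_assoc sk)
  also have "\<dots> = ?a \<otimes> (?a \<otimes> ?a [^] k)" by (simp only: pw(1) s_rho_prod[unfolded nk])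
  also have "\<dots> = (?a \<otimes> ?a) \<otimes> ?a [^] k" using pw(2) by (simp add: m_assoc)
  finally have "s k \<otimes> (?a \<otimes> (?a \<otimes> s 0)) \<otimes> ?a [^] k = (?a \<otimes> ?a) \<otimes> ?a [^] k" .
  then have e: "s k \<otimes> (?a \<otimes> (?a \<otimes> s 0)) = ?a \<otimes> ?a"
    using pw(2) by simp
  have h: "half_twist N \<otimes> s k = s 0 \<otimes> half_twist N" using half_twist_s[of k N] k by simp
  have "alpha k \<otimes> (c \<otimes> alpha k) = s k \<otimes> (?a \<otimes> ?a) \<otimes> (half_twist N \<otimes> s k) \<otimes> ?a"
    by (simp add: b c_def m_assoc)
  also have "\<dots> = s k \<otimes> (?a \<otimes> (?a \<otimes> s 0)) \<otimes> (half_twist N \<otimes> ?a)"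
    by (simp only: h) (simp add: m_assoc)
  also have "\<dots> = ?a \<otimes> (?a \<otimes> (half_twist N \<otimes> ?a))"
    by (simp only: e) (simp add: m_assoc)
  also have "\<dots> = c" by (simp only: alpha_half_twist c_def)
  finally show ?thesis by (simp add: k)
qed

end

section \<open>The action on pairs of strands\<close>

text \<open>A right action of the presented group on \<open>Q\<close>, specified by letters; the
  first letter of a word acts first.\<close>

lemma word_eq_fold:
  assumes closed: "\<And>g e x. g \<in> S \<Longrightarrow> x \<in> Q \<Longrightarrow> act (g, e) x \<in> Q"
    and cancel: "\<And>g e x. g \<in> S \<Longrightarrow> x \<in> Q \<Longrightarrow> act (g, \<not> e) (act (g, e) x) = x"
    and rel: "\<And>u v x. (u, v) \<in> R \<Longrightarrow> x \<in> Q \<Longrightarrow> fold act u x = fold act v x"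
    and "word_eq S R u v" "x \<in> Q"
  shows "fold act u x = fold act v x"
  using assms(4,5)
proof (induction arbitrary: x rule: word_eq.induct)
  case (append u u' v v')
  have "fold act w x \<in> Q" if "w \<in> words S" "x \<in> Q" for w x
    using that by (induction w arbitrary: x) (auto simp: words_def closed)
  then show ?case using append word_eq_words[OF append(1)] by simp
next
  case (rel u v)
  then show ?case using assms(3) by blast
qed (simp_all add: cancel)

text \<open>Left multiplication by the quaternion unit i; \<open>quat_j\<close> is that by
  j.\<close>

definition quat_i :: "complex \<times> complex \<Rightarrow> complex \<times> complex" where
  "quat_i v = (\<i> * fst v, \<i> * snd v)"
definition quat_j :: "complex \<times> complex \<Rightarrow> complex \<times> complex" where
  "quat_j v = (- cnj (snd v), cnj (fst v))"

lemma quat [simp]: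
  "quat_i (quat_i v) = - v" "quat_j (quat_j v) = - v" "quat_j (quat_i v) = - quat_i (quat_j v)"
  "quat_i (- v) = - quat_i v" "quat_j (- v) = - quat_j v"
  by (simp_all add: quat_i_def quat_j_def prod_eq_iff)

definition swap :: "nat \<Rightarrow> nat \<Rightarrow> nat" where
  "swap i p = (if p = i then Suc i else if p = Suc i then i else p)"

lemma swap_eq:
  "swap i p = i \<longleftrightarrow> p = Suc i" "swap i p = Suc i \<longleftrightarrow> p = i"
  "k \<noteq> i \<Longrightarrow> k \<noteq> Suc i \<Longrightarrow> swap i p = k \<longleftrightarrow> p = k"
  by (auto simp: swap_def)

lemma swap_away:
  assumes "j \<noteq> i" "j \<noteq> i + 1"
  shows "swap i k = j \<longleftrightarrow> k = j" "swap i j = j" "j < swap i k \<longleftrightarrow> j < k" "swap i k < j \<longleftrightarrow> k < j"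
  using assms by (auto simp: swap_def)

lemma swap_commute:
  "i \<noteq> j \<Longrightarrow> Suc i \<noteq> j \<Longrightarrow> i \<noteq> Suc j \<Longrightarrow> swap i (swap j p) = swap j (swap i p)"
  by (auto simp: swap_def)

lemma swap_braid: "swap i (swap (Suc i) (swap i p)) = swap (Suc i) (swap i (swap (Suc i) p))"
  by (auto simp: swap_def)

text \<open>
  A state \<open>(p, q, v)\<close> follows an ordered pair of strands, at positions \<open>p\<close> and \<open>q\<close>, and a
  quaternion \<open>v = fst v + snd v j\<close>. The pure braid group of the projective plane on two strands is
  the quaternion group, with \<open>\<rho>\<^sub>1 = i\<close>, \<open>\<rho>\<^sub>2 = j\<close> and \<open>\<sigma>\<^sub>1\<^sup>2 = -1\<close>. The sign of the full twist is
  charged to the crossing that restores \<open>p < q\<close>, and for \<open>p > q\<close> the values of the \<open>\<rho>\<close>'s are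
  conjugated accordingly.
\<close>

fun strand_act :: "vb_gen \<times> bool \<Rightarrow> nat \<times> nat \<times> complex \<times> complex \<Rightarrow> nat \<times> nat \<times> complex \<times> complex"
  where
  "strand_act (Sigma i, e) (p, q, v) =
     (swap i p, swap i q, if p = (if e then Suc i else i) \<and> q = (if e then i else Suc i) then - v else v)"
| "strand_act (Rho j, e) (p, q, v) =
     (p, q, if j = p then (if e = (p < q) then quat_i v else - quat_i v)
            else if j = q then (if e = (p < q) then quat_j v else - quat_j v) else v)"

definition strand_states :: "nat \<Rightarrow> (nat \<times> nat \<times> complex \<times> complex) set" where
  "strand_states n = {(p, q, v). p \<in> {1..n} \<and> q \<in> {1..n} \<and> p \<noteq> q}"

text \<open>The strand at position 1 passes all others up to position \<open>Suc k\<close>; a sign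
  arises if it is the second of the pair and passes the first.\<close>

lemma fold_up:
  assumes "1 \<le> p" "1 \<le> q" "p \<noteq> q"
  shows "fold strand_act (map sig [1..<Suc k]) (p, q, v) =
    (if p = 1 then Suc k else if p \<le> Suc k then p - 1 else p,
     if q = 1 then Suc k else if q \<le> Suc k then q - 1 else q,
     if q = 1 \<and> p \<le> Suc k then - v else v)"
  using assms by (induction k) (auto simp: swap_def)

lemma fold_down:
  assumes "1 \<le> p" "1 \<le> q" "p \<noteq> q"
  shows "fold strand_act (map sig (rev [1..<Suc k])) (p, q, v) =
    (if p = Suc k then 1 else if p \<le> k then Suc p else p,
     if q = Suc k then 1 else if q \<le> k then Suc q else q,
     if p = Suc k \<and> q \<le> k then - v else v)"
  using assms by (induction k arbitrary: p q v) (auto simp: swap_def)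

lemma fold_rels:
  assumes n: "n \<ge> 2" and "(u, v) \<in> vb_rels n" "x \<in> strand_states n"
  shows "fold strand_act u x = fold strand_act v x"
proof -
  obtain p q z where x: "x = (p, q, z)" by (cases x)
  have pq: "1 \<le> p" "1 \<le> q" "p \<le> n" "q \<le> n" "p \<noteq> q"
    using assms(3) x by (auto simp: strand_states_def)
  from assms(2) consider
      (far) i j where "u = [sig i, sig j]" "v = [sig j, sig i]" "\<bar>int i - int j\<bar> \<ge> 2"
    | (braid) i where "u = [sig i, sig (i + 1), sig i]" "v = [sig (i + 1), sig i, sig (i + 1)]"
    | (s_r) i j where "u = [sig i, rho j]" "v = [rho j, sig i]" "j \<noteq> i" "j \<noteq> i + 1"
    | (r_Suc) i where "u = [rho (i + 1)]" "v = [sig_inv i, rho i, sig_inv i]"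
    | (r_r) i where "u = [rho_inv (i + 1), rho_inv i, rho (i + 1), rho i]" "v = [sig i, sig i]"
    | (r_sq) "u = [rho 1, rho 1]"
        "v = map sig [1..<n - 1] @ [sig (n - 1), sig (n - 1)] @ map sig (rev [1..<n - 1])"
    unfolding vb_rels_def by auto
  then show ?thesis
  proof cases
    case far
    then have "i \<noteq> j" "Suc i \<noteq> j" "i \<noteq> Suc j" by auto
    with far(1,2) show ?thesis by (auto simp: x swap_eq swap_commute)
  next
    case braid
    then show ?thesis by (auto simp: x swap_eq swap_braid)
  next
    case s_r
    then show ?thesis
      by (cases "p = j"; cases "q = j") (simp_all add: x swap_away eq_commute[of j])
  next
    case r_Suc
    then show ?thesis using pq
      by (cases "p = i"; cases "p = Suc i"; cases "q = i"; cases "q = Suc i") (auto simp: x swap_def)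
  next
    case r_r
    then show ?thesis using pq
      by (cases "p = i"; cases "p = Suc i"; cases "q = i"; cases "q = Suc i") (auto simp: x swap_def)
  next
    case r_sq
    obtain k where k: "n = Suc (Suc k)" using n by (metis One_nat_def Suc_1 Suc_le_D Suc_le_mono)
    \<comment> \<open>This word takes the strand at position 1 past all others and back, with one
      sign if the pair contains it; this agrees with the squares of i and j.\<close>
    have "v = map sig [1..<Suc (Suc k)] @ map sig (rev [1..<Suc (Suc k)])" by (simp add: r_sq(2) k)
    then have "fold strand_act v x = (p, q, if p = 1 \<or> q = 1 then - z else z)"
      using pq by (auto simp: x fold_up[unfolded One_nat_def] fold_down[unfolded One_nat_def] k simp del: upt_Suc)
    then show ?thesis using pq r_sq(1) by (auto simp: x)
  qed
qed

section \<open>Detecting nontrivial elements by the action\<close>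

lemma braid_eq_fold:
  assumes "n \<ge> 2" "u \<in> words (vb_gens n)" "braid n u = braid n v" "x \<in> strand_states n"
  shows "fold strand_act u x = fold strand_act v x"
proof (rule word_eq_fold[where S = "vb_gens n" and R = "vb_rels n" and Q = "strand_states n"])
  show "word_eq (vb_gens n) (vb_rels n) u v"
    using assms(2,3) by (simp add: braid_def word_class_eq_iff)
next
  fix g e x assume *: "g \<in> vb_gens n" "x \<in> strand_states n"
  obtain p q z where "x = (p, q, z)" by (cases x)
  with * show "strand_act (g, e) x \<in> strand_states n" "strand_act (g, \<not> e) (strand_act (g, e) x) = x"
    by (cases g; auto simp: vb_gens_def strand_states_def swap_def)+
qed (use assms fold_rels in auto)

lemma fst_fold_cycle:
  assumes "1 \<le> fst x"
  shows "fst (fold strand_act (map sig_inv (rev [1..<Suc k])) x) =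
    (if fst x = Suc k then 1 else if fst x \<le> k then Suc (fst x) else fst x)"
  using assms
proof (induction k arbitrary: x)
  case (Suc k)
  obtain p q z where x: "x = (p, q, z)" by (cases x)
  define y where "y = strand_act (sig_inv (Suc k)) x"
  have step: "fold strand_act (map sig_inv (rev [1..<Suc (Suc k)])) x
      = fold strand_act (map sig_inv (rev [1..<Suc k])) y" by (simp add: y_def)
  have y: "fst y = swap (Suc k) p" by (simp add: x y_def)
  then have "1 \<le> fst y" using Suc.prems by (auto simp: x swap_def)
  from Suc.IH[OF this] show ?case
    using Suc.prems unfolding step by (auto simp: y x swap_def simp del: upt_Suc)
qed auto

text \<open>The letter \<open>rho 1\<close> moves no strand, so the powers of \<open>alpha k\<close>
  move the first strand cyclically through \<open>Suc k\<close> positions.\<close>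

lemma fst_fold_cycle_pow:
  "fst (fold strand_act (concat (replicate j (map sig_inv (rev [1..<Suc k]) @ [rho 1]))) (1, x))
     = Suc (j mod Suc k)"
proof (induction j)
  case (Suc j)
  let ?w = "map sig_inv (rev [1..<Suc k]) @ [rho 1]"
  let ?y = "fold strand_act (concat (replicate j ?w)) (1, x)"
  have "concat (replicate (Suc j) ?w) = concat (replicate j ?w) @ ?w"
    by (simp only: replicate_Suc replicate_append_same[symmetric] concat_append) simp
  moreover have "fst (strand_act (rho 1) y) = fst y" for y by (cases y) simp
  ultimately have "fst (fold strand_act (concat (replicate (Suc j) ?w)) (1, x))
      = fst (fold strand_act (map sig_inv (rev [1..<Suc k])) ?y)"
    by (simp del: upt_Suc)
  also have "\<dots> = Suc (Suc j mod Suc k)"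
    using fst_fold_cycle[of ?y k] Suc mod_less_divisor[of "Suc k" j]
    by (simp add: mod_Suc del: upt_Suc mod_less_divisor) 
  finally show ?case .
qed simp

text \<open>Only \<open>rho 2\<close> and \<open>rho 1\<close> concern this pair. Acting twice, the
  word gives (ij)^2 = -1.\<close>

lemma fold_rho_prod:
  assumes "n \<ge> 2"
  shows "fold strand_act (map rho (rev [1..<Suc n])) (1, 2, v) = (1, 2, quat_i (quat_j v))"
proof -
  have "[1..<Suc n] = [1, 2] @ [3..<Suc n]"
    using assms by (simp add: upt_conv_Cons numeral_eq_Suc del: upt_Suc)
  then have split: "map rho (rev [1..<Suc n]) = map rho (rev [3..<Suc n]) @ [rho 2, rho 1]" by simp
  have "fold strand_act (map rho xs) (1, 2, v) = (1, 2, v)" if "set xs \<subseteq> {3..}" for xs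
    using that by (induction xs) auto
  from this[of "rev [3..<Suc n]"]
  have "fold strand_act (map rho (rev [3..<Suc n])) (1, 2, v) = (1, 2, v)" by fastforce
  then show ?thesis by (simp only: split fold_append o_apply) simp
qed

lemma (in group) ord_eq_four_times:
  assumes "x \<in> carrier G" "k > 0" "x [^] (2 * (2 * k)) = \<one>" "x [^] (2 * k) \<noteq> \<one>"
    and "\<And>j::nat. x [^] j = \<one> \<Longrightarrow> k dvd j"
  shows "ord x = 2 * (2 * k)"
proof -
  have "k dvd ord x" using assms(1,5) pow_ord_eq_1 by blast
  then obtain c where c: "ord x = k * c" by blast
  have "k * c dvd 2 * (2 * k)" using assms(1,3) pow_eq_id c by metis
  then have "k * c dvd k * 4" by (simp add: mult.commute)
  then have "c dvd 4" using assms(2) by simp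
  moreover have "\<not> k * c dvd 2 * k" using assms(1,4) pow_eq_id c by metis
  then have "\<not> c dvd 2" using assms(2) by (simp add: mult.commute)
  moreover have "c \<le> 4" using \<open>c dvd 4\<close> by (simp add: dvd_imp_le)
  then have "c \<in> {0, 1, 2, 3, 4}" by auto
  ultimately have "c = 4" by auto
  then show ?thesis using c by simp
qed

section \<open>The dicyclic subgroups\<close>

lemma braid_mult:
  assumes "u \<in> words (vb_gens n)" "v \<in> words (vb_gens n)"
  shows "braid n u \<otimes>\<^bsub>braid_group_RP2 n\<^esub> braid n v = braid n (u @ v)"
  using assms by (simp add: braid_def braid_group_RP2_def mult_presented_group)

lemma braid_Nil: "braid n [] = \<one>\<^bsub>braid_group_RP2 n\<^esub>"
  by (simp add: braid_def braid_group_RP2_def presented_group_def)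

lemma group_braid_group_RP2: "group (braid_group_RP2 n)"
  by (simp add: braid_group_RP2_def group_presented_group)

lemma braid_eqI:
  assumes "word_eq (vb_gens n) (vb_rels n) u v"
  shows "braid n u = braid n v"
  using assms word_eq_words[OF assms] by (simp add: braid_def word_class_eq_iff)

lemma braid_relI:
  assumes "n \<ge> 2" "(u, v) \<in> vb_rels n"
  shows "braid n u = braid n v"
  using vb_rels_words[OF assms(1)] assms(2) by (intro braid_eqI word_eq.rel) auto

lemma braid_inv:
  assumes "w \<in> words (vb_gens n)"
  shows "inv\<^bsub>braid_group_RP2 n\<^esub> (braid n w) = braid n (inv_word w)"
proof -
  interpret group "braid_group_RP2 n" by (rule group_braid_group_RP2)
  have "braid n (inv_word w) \<otimes>\<^bsub>braid_group_RP2 n\<^esub> braid n w = \<one>\<^bsub>braid_group_RP2 n\<^esub>"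
    using assms by (simp add: braid_mult inv_word_words braid_Nil[symmetric] braid_eqI inv_word_left)
  then show ?thesis using assms by (intro inv_equality) (auto intro: braid_closed inv_word_words)
qed

lemma braid_pow:
  assumes "w \<in> words (vb_gens n)"
  shows "braid n w [^]\<^bsub>braid_group_RP2 n\<^esub> (k::nat) = braid n (concat (replicate k w))"
proof -
  interpret group "braid_group_RP2 n" by (rule group_braid_group_RP2)
  show ?thesis
  proof (induction k)
    case (Suc k)
    have "concat (replicate k w) \<in> words (vb_gens n)"
      using assms by (induction k) (auto simp: words_def)
    then show ?case using assms nat_pow_Suc2[OF braid_closed[OF assms], of k]
      by (simp add: Suc braid_mult del: nat_pow_Suc)
  qed (simp add: braid_Nil)
qed

text \<open>Outside the index range of the generators, the two families below are the identity.\<close>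

definition sigma_elt :: "nat \<Rightarrow> nat \<Rightarrow> vb_gen word set" where
  "sigma_elt n i = braid n (if Suc i < n then [sig (Suc i)] else [])"
definition rho_elt :: "nat \<Rightarrow> nat \<Rightarrow> vb_gen word set" where
  "rho_elt n i = braid n (if i < n then [rho (Suc i)] else [])"

section \<open>Van Buskirk's generators as an instance of the abstract setting\<close>

lemma sigma_words:
  "k \<le> n \<Longrightarrow> map sig [Suc 0..<k] \<in> words (vb_gens n)" "k \<le> n \<Longrightarrow> map sig (rev [Suc 0..<k]) \<in> words (vb_gens n)"
  "k \<le> n \<Longrightarrow> map sig_inv (rev [Suc 0..<k]) \<in> words (vb_gens n)"
  "k \<le> Suc n \<Longrightarrow> map rho (rev [Suc 0..<k]) \<in> words (vb_gens n)"
  by (auto simp: words_def vb_gens_def)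

lemma letter_words:
  "[] \<in> words (vb_gens n)"
  "Suc i < n \<Longrightarrow> [(Sigma (Suc i), e)] \<in> words (vb_gens n)"
  "i < n \<Longrightarrow> [(Rho (Suc i), e)] \<in> words (vb_gens n)"
  by (auto simp: words_def vb_gens_def)

lemma words_append: "u \<in> words S \<Longrightarrow> v \<in> words S \<Longrightarrow> u @ v \<in> words S"
  by (auto simp: words_def)

lemma sigma_elt: "i < n - 1 \<Longrightarrow> sigma_elt n i = braid n [sig (Suc i)]"
  by (simp add: sigma_elt_def less_diff_conv)

lemma rho_elt: "i < n \<Longrightarrow> rho_elt n i = braid n [rho (Suc i)]"
  by (simp add: rho_elt_def)

text \<open>The locale predicate is a hypothesis because the lemma already serves to verify the
  surface relation of \<open>RP2_braids\<close>.\<close>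

lemma up_down_braid:
  assumes "projective_braids (braid_group_RP2 n) (sigma_elt n) (rho_elt n) (n - 1)" "k \<le> n - 1"
  shows "projective_braids.up (braid_group_RP2 n) (sigma_elt n) k = braid n (map sig [1..<Suc k])"
    and "projective_braids.down (braid_group_RP2 n) (sigma_elt n) k = braid n (map sig (rev [1..<Suc k]))"
proof -
  interpret projective_braids "braid_group_RP2 n" "sigma_elt n" "rho_elt n" "n - 1" by fact
  have "up k = braid n (map sig [1..<Suc k]) \<and> down k = braid n (map sig (rev [1..<Suc k]))"
    using assms(2)
  proof (induction k)
    case (Suc k)
    have "map sig [1..<Suc (Suc k)] = map sig [1..<Suc k] @ [sig (Suc k)]"
      and "map sig (rev [1..<Suc (Suc k)]) = [sig (Suc k)] @ map sig (rev [1..<Suc k])" by simp_all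
    then show ?case using Suc
      by (simp add: sigma_elt braid_mult sigma_words letter_words del: upt_Suc)
  qed (simp add: braid_Nil)
  then show "up k = braid n (map sig [1..<Suc k])" "down k = braid n (map sig (rev [1..<Suc k]))"
    by blast+
qed

lemma RP2_braids_braid_group:
  assumes "n \<ge> 2"
  shows "RP2_braids (braid_group_RP2 n) (sigma_elt n) (rho_elt n) (n - 1)"
proof -
  interpret group "braid_group_RP2 n" by (rule group_braid_group_RP2)
  let ?mult = "monoid.mult (braid_group_RP2 n)"
  note letters = letter_words words_append[of "[_]" _ "_ # _", simplified]
  note s = sigma_elt
  have r: "rho_elt n i = braid n [rho (Suc i)]" if "i \<le> n - 1" for i
    using that assms by (simp add: rho_elt)
  have s_inv: "inv\<^bsub>braid_group_RP2 n\<^esub> (sigma_elt n i) = braid n [sig_inv (Suc i)]" if "i < n - 1" for i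
    using that by (simp add: s braid_inv letters inv_word_def)
  have r_inv: "inv\<^bsub>braid_group_RP2 n\<^esub> (rho_elt n i) = braid n [rho_inv (Suc i)]" if "i \<le> n - 1" for i
    using that assms by (simp add: r braid_inv letters inv_word_def)
  have c [simp]: "sigma_elt n i \<in> carrier (braid_group_RP2 n)" "rho_elt n i \<in> carrier (braid_group_RP2 n)" for i
    by (auto simp: sigma_elt_def rho_elt_def letters intro!: braid_closed)
  interpret projective_braids "braid_group_RP2 n" "sigma_elt n" "rho_elt n" "n - 1"
  proof
    fix i j assume "Suc i < j" "j < n - 1"
    moreover from this have "braid n [sig (Suc i), sig (Suc j)] = braid n [sig (Suc j), sig (Suc i)]"
      by (intro braid_relI[OF assms]) (auto simp: vb_rels_def)
    ultimately show "?mult (sigma_elt n i) (sigma_elt n j) = ?mult (sigma_elt n j) (sigma_elt n i)"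
      by (simp add: s braid_mult letters)
  next
    fix i assume "Suc i < n - 1"
    moreover from this have "braid n [sig (Suc i), sig (Suc i + 1), sig (Suc i)]
        = braid n [sig (Suc i + 1), sig (Suc i), sig (Suc i + 1)]"
      by (intro braid_relI[OF assms]) (auto simp: vb_rels_def)
    ultimately show "?mult (sigma_elt n i) (?mult (sigma_elt n (Suc i)) (sigma_elt n i))
        = ?mult (sigma_elt n (Suc i)) (?mult (sigma_elt n i) (sigma_elt n (Suc i)))"
      by (simp add: s braid_mult letters)
  next
    fix i j assume "i < n - 1" "j \<le> n - 1" "j \<noteq> i" "j \<noteq> Suc i"
    moreover from this have "braid n [sig (Suc i), rho (Suc j)] = braid n [rho (Suc j), sig (Suc i)]"
      by (intro braid_relI[OF assms]) (auto simp: vb_rels_def)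
    ultimately show "?mult (sigma_elt n i) (rho_elt n j) = ?mult (rho_elt n j) (sigma_elt n i)"
      by (simp add: s r braid_mult letters)
  next
    fix i assume i: "i < n - 1"
    then have "braid n [rho (Suc i + 1)] = braid n [sig_inv (Suc i), rho (Suc i), sig_inv (Suc i)]"
      by (intro braid_relI[OF assms]) (auto simp: vb_rels_def)
    then have e: "rho_elt n (Suc i) = ?mult (inv\<^bsub>braid_group_RP2 n\<^esub> (sigma_elt n i))
        (?mult (rho_elt n i) (inv\<^bsub>braid_group_RP2 n\<^esub> (sigma_elt n i)))"
      using i by (simp add: s_inv r braid_mult letters)
    show "?mult (sigma_elt n i) (?mult (rho_elt n (Suc i)) (sigma_elt n i)) = rho_elt n i"
      by (simp add: e m_assoc) (simp add: m_assoc[symmetric])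
    have "braid n [rho_inv (Suc i + 1), rho_inv (Suc i), rho (Suc i + 1), rho (Suc i)]
        = braid n [sig (Suc i), sig (Suc i)]"
      using i by (intro braid_relI[OF assms]) (auto simp: vb_rels_def)
    moreover have "?mult (inv\<^bsub>braid_group_RP2 n\<^esub> (rho_elt n (Suc i)))
        (?mult (inv\<^bsub>braid_group_RP2 n\<^esub> (rho_elt n i)) (?mult (rho_elt n (Suc i)) (rho_elt n i)))
        = braid n [rho_inv (Suc i + 1), rho_inv (Suc i), rho (Suc i + 1), rho (Suc i)]"
      using i by (simp add: r_inv) (simp add: r braid_mult letters)
    moreover have "braid n [sig (Suc i), sig (Suc i)] = ?mult (sigma_elt n i) (sigma_elt n i)"
      using i by (simp add: s braid_mult letters)
    ultimately have "?mult (inv\<^bsub>braid_group_RP2 n\<^esub> (rho_elt n (Suc i)))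
        (?mult (inv\<^bsub>braid_group_RP2 n\<^esub> (rho_elt n i)) (?mult (rho_elt n (Suc i)) (rho_elt n i)))
        = ?mult (sigma_elt n i) (sigma_elt n i)" by (simp only:)
    then show "?mult (rho_elt n (Suc i)) (rho_elt n i)
        = ?mult (rho_elt n i) (?mult (rho_elt n (Suc i)) (?mult (sigma_elt n i) (sigma_elt n i)))"
      by (simp only: inv_solve_left' m_closed inv_closed c)
  qed simp_all
  show ?thesis
  proof
    note up = up_down_braid[OF projective_braids_axioms]
    show "0 < n - 1" using assms by simp
    \<comment> \<open>The doubled letter \<open>sig (n - 1)\<close> is shared between the ascending
      and the descending word.\<close>
    have "[1..<Suc (n - 1)] = [1..<n - 1] @ [n - 1]" using assms by (intro upt_Suc_append) simp
    then have "map sig [1..<n - 1] @ [sig (n - 1), sig (n - 1)] @ map sig (rev [1..<n - 1])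
        = map sig [1..<Suc (n - 1)] @ map sig (rev [1..<Suc (n - 1)])" by simp
    moreover have "braid n [rho 1, rho 1]
        = braid n (map sig [1..<n - 1] @ [sig (n - 1), sig (n - 1)] @ map sig (rev [1..<n - 1]))"
      by (intro braid_relI[OF assms]) (auto simp: vb_rels_def)
    ultimately show "?mult (rho_elt n 0) (rho_elt n 0) = ?mult (up (n - 1)) (down (n - 1))"
      using assms by (simp add: up r braid_mult sigma_words letters del: upt_Suc)
  qed
qed

lemma (in group) inverted_by:
  assumes "x \<in> carrier G" "y \<in> carrier G" "x \<otimes> (y \<otimes> x) = y"
  shows "y \<otimes> x = inv x \<otimes> y" "y \<otimes> inv x = x \<otimes> y"
proof -
  have "inv x \<otimes> (x \<otimes> (y \<otimes> x)) = y \<otimes> x" using assms(1,2) by (simp add: m_assoc[symmetric])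
  then show "y \<otimes> x = inv x \<otimes> y" by (simp only: assms(3))
  have "x \<otimes> (y \<otimes> x) \<otimes> inv x = x \<otimes> y" using assms(1,2) by (simp add: m_assoc)
  then show "y \<otimes> inv x = x \<otimes> y" by (simp only: assms(3))
qed

theorem proposition15:
  fixes n :: nat
  assumes "n \<ge> 2"
  shows "subgroup_generated (braid_group_RP2 n) {elt_a n, elt_Delta n}
           \<cong> dicyclic_group (2 * n)
       \<and> subgroup_generated (braid_group_RP2 n)
           {elt_b n, elt_Delta n \<otimes>\<^bsub>braid_group_RP2 n\<^esub> inv\<^bsub>braid_group_RP2 n\<^esub> elt_a n}
           \<cong> dicyclic_group (2 * (n - 1))"
proof -
  interpret RP2_braids "braid_group_RP2 n" "sigma_elt n" "rho_elt n" "n - 1"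
    by (rule RP2_braids_braid_group[OF assms])
  let ?G = "braid_group_RP2 n"
  note up = up_down_braid(1)[OF projective_braids_axioms]
  have r: "rho_elt n i = braid n [rho (Suc i)]" if "i \<le> n - 1" for i
    using that assms by (simp add: rho_elt)
  have alpha: "alpha k = braid n (map sig_inv (rev [1..<Suc k]) @ [rho 1])" if "k \<le> n - 1" for k
  proof -
    have "inv_word (map sig [1..<Suc k]) = map sig_inv (rev [1..<Suc k])"
      by (simp add: inv_word_def rev_map del: upt_Suc)
    then show ?thesis using that assms
      by (simp add: alpha_eq up braid_inv r braid_mult sigma_words letter_words del: upt_Suc)
  qed
  have aw: "map sig_inv (rev [1..<Suc k]) @ [rho 1] \<in> words (vb_gens n)" if "k \<le> n - 1" for k
    using that assms by (auto simp: words_def vb_gens_def)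
  have half_twist: "half_twist k = braid n (concat (map (\<lambda>k. map sig [1..<k + 1]) (rev [1..<Suc k])))"
    if "k \<le> n - 1" for k
    using that
  proof (induction k)
    case (Suc k)
    then have "concat (map (\<lambda>k. map sig [1..<k + 1]) (rev [1..<Suc k])) \<in> words (vb_gens n)"
      by (auto simp: words_def vb_gens_def)
    with Suc show ?case by (simp add: up braid_mult sigma_words del: up.simps upt_Suc) (simp add: up)
  qed (simp add: braid_Nil)
  have rho_prod: "rho_prod k = braid n (map rho (rev [1..<Suc (Suc k)]))" if "k \<le> n - 1" for k
    using that
  proof (induction k)
    case (Suc k)
    then show ?case using sigma_words(4)[of "Suc (Suc k)" n]
      by (simp add: r braid_mult letter_words)
  qed (use assms in \<open>simp add: r\<close>)
  have n: "Suc (n - 1) = n" "Suc (n - 1 - 1) = n - 1" using assms by auto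
  have a: "elt_a n = alpha (n - 1)"
    using alpha[of "n - 1"] by (simp only: n elt_a_def order_refl)
  \<comment> \<open>One strand fewer than for \<open>a\<close>; for \<open>n = 2\<close> this is
    \<open>alpha 0\<close>, the first \<open>rho\<close>.\<close>
  have b: "elt_b n = alpha (n - 1 - 1)"
    using alpha[of "n - 1 - 1"] by (simp only: n elt_b_def diff_le_self)
  have D: "elt_Delta n = half_twist (n - 1)"
    using half_twist[of "n - 1"] by (simp only: n elt_Delta_def order_refl)
  let ?D = "half_twist (n - 1)" and ?a = "alpha (n - 1)" and ?b = "alpha (n - 1 - 1)"
  let ?y = "?D \<otimes>\<^bsub>?G\<^esub> inv\<^bsub>?G\<^esub> ?a"
  have twist: "?D \<otimes>\<^bsub>?G\<^esub> ?D \<noteq> \<one>\<^bsub>?G\<^esub>"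
  proof
    \<comment> \<open>The full twist is the square of \<open>rho_prod (n - 1)\<close>, so it negates
      the quaternion 1 carried by the first two strands.\<close>
    let ?w = "map rho (rev [1..<Suc n])"
    assume "?D \<otimes>\<^bsub>?G\<^esub> ?D = \<one>\<^bsub>?G\<^esub>"
    moreover have "rho_prod (n - 1) = braid n ?w"
      using rho_prod[of "n - 1"] by (simp only: n order_refl)
    moreover have w: "?w \<in> words (vb_gens n)" by (simp add: sigma_words del: upt_Suc)
    ultimately have "braid n (?w @ ?w) = braid n []"
      using rho_prod_sq by (simp only: braid_mult[OF w w, symmetric] braid_Nil)
    moreover have "?w @ ?w \<in> words (vb_gens n)" using w by (intro words_append)
    moreover have "(1, 2, 1, 0) \<in> strand_states n" using assms by (simp add: strand_states_def)
    ultimately have "fold strand_act (?w @ ?w) (1, 2, 1, 0) = fold strand_act [] (1, 2, 1, 0)"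
      by (intro braid_eq_fold[OF assms])
    moreover have "fold strand_act ?w (1, 2, v) = (1, 2, quat_i (quat_j v))" for v
      by (rule fold_rho_prod[OF assms])
    ultimately show False by (simp only: fold_append o_apply) simp
  qed
  have cycle: "Suc k dvd j" if "k \<le> n - 1" "alpha k [^]\<^bsub>?G\<^esub> (j::nat) = \<one>\<^bsub>?G\<^esub>" for k j
  proof -
    let ?w = "concat (replicate j (map sig_inv (rev [1..<Suc k]) @ [rho 1]))"
    have "braid n ?w = braid n []" using that aw[of k] by (simp only: alpha braid_pow braid_Nil)
    moreover have "?w \<in> words (vb_gens n)"
      using aw[OF that(1)] by (induction j) (auto simp: words_def)
    moreover have "(1, 2, 0) \<in> strand_states n" using assms by (simp add: strand_states_def)
    ultimately have "fold strand_act ?w (1, 2, 0) = fold strand_act [] (1, 2, 0)"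
      by (intro braid_eq_fold[OF assms])
    then have "Suc (j mod Suc k) = 1"
      using fst_fold_cycle_pow[of j k "(2, 0)"] by simp
    then show ?thesis by (simp add: mod_eq_0_iff_dvd)
  qed
  \<comment> \<open>The second fact says \<open>?y = ?a \<otimes> ?D\<close>, the element in
    \<open>alpha_pred_half_twist\<close>.\<close>
  note c = inverted_by[OF closed(5,3) alpha_half_twist]
  have y: "?y \<in> carrier ?G" by simp
  have a_pow: "?a [^]\<^bsub>?G\<^esub> (2 * n) = ?D \<otimes>\<^bsub>?G\<^esub> ?D"
    using alpha_pow_eq by (simp only: n)
  have yy: "?y \<otimes>\<^bsub>?G\<^esub> ?y = ?D \<otimes>\<^bsub>?G\<^esub> ?D"
  proof -
    have "?y \<otimes>\<^bsub>?G\<^esub> ?y = ?D \<otimes>\<^bsub>?G\<^esub> inv\<^bsub>?G\<^esub> ?a \<otimes>\<^bsub>?G\<^esub> (?a \<otimes>\<^bsub>?G\<^esub> ?D)" by (simp only: c(2))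
    also have "\<dots> = ?D \<otimes>\<^bsub>?G\<^esub> (inv\<^bsub>?G\<^esub> ?a \<otimes>\<^bsub>?G\<^esub> ?a) \<otimes>\<^bsub>?G\<^esub> ?D"
      by (simp only: m_assoc closed m_closed inv_closed)
    also have "\<dots> = ?D \<otimes>\<^bsub>?G\<^esub> ?D" by simp
    finally show ?thesis .
  qed
  have b_pow: "?b [^]\<^bsub>?G\<^esub> (2 * (n - 1)) = ?y \<otimes>\<^bsub>?G\<^esub> ?y"
    by (simp only: yy alpha_pred_pow_eq)
  have yb: "?y \<otimes>\<^bsub>?G\<^esub> ?b = inv\<^bsub>?G\<^esub> ?b \<otimes>\<^bsub>?G\<^esub> ?y"
    using inverted_by(1)[OF closed(5) _ alpha_pred_half_twist] by (simp only: c(2) closed m_closed)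
  \<comment> \<open>Used for \<open>?a\<close> with \<open>?D\<close> and for \<open>?b\<close> with
    \<open>?y\<close>; in both cases the square of \<open>z\<close> is the full twist.\<close>
  have ord: "ord (alpha k) = 2 * (2 * Suc k)"
    if "k \<le> n - 1" "z \<in> carrier ?G" "z \<otimes>\<^bsub>?G\<^esub> alpha k = inv\<^bsub>?G\<^esub> (alpha k) \<otimes>\<^bsub>?G\<^esub> z"
      "alpha k [^]\<^bsub>?G\<^esub> (2 * Suc k) = z \<otimes>\<^bsub>?G\<^esub> z" "z \<otimes>\<^bsub>?G\<^esub> z \<noteq> \<one>\<^bsub>?G\<^esub>" for k z
  proof (rule ord_eq_four_times)
    show "alpha k [^]\<^bsub>?G\<^esub> (2 * (2 * Suc k)) = \<one>\<^bsub>?G\<^esub>"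
      using that(2-4) by (intro dicyclic_pow_double closed)
    show "alpha k [^]\<^bsub>?G\<^esub> (2 * Suc k) \<noteq> \<one>\<^bsub>?G\<^esub>" using that(4,5) by (simp only: not_False_eq_True)
    show "Suc k dvd j" if "alpha k [^]\<^bsub>?G\<^esub> j = \<one>\<^bsub>?G\<^esub>" for j :: nat
      using cycle that \<open>k \<le> n - 1\<close> by blast
  qed simp_all
  have "ord ?a = 2 * (2 * n)"
    using ord[OF order_refl closed(3) c(1)] a_pow twist by (simp only: n simp_thms)
  with a_pow c(1) assms have "subgroup_generated ?G {?a, ?D} \<cong> dicyclic_group (2 * n)"
    by (intro subgroup_generated_iso_dicyclic) simp_all
  moreover have "ord ?b = 2 * (2 * (n - 1))"
    using ord[OF diff_le_self y yb] b_pow twist by (simp only: n yy simp_thms)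
  then have "subgroup_generated ?G {?b, ?y} \<cong> dicyclic_group (2 * (n - 1))"
    using assms by (intro subgroup_generated_iso_dicyclic[OF closed(5) y yb b_pow]) simp_all
  ultimately show ?thesis by (simp only: a b D)
qed

end
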